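(* Fix $k,m\in\mathbb{N}$ with $k\ge m$. Then, as $n\to\infty$, the random vector $$\left(\frac{m!\,S_m}{\log n},\ \frac{(m+1)!\,S_{m+1}}{(\log n)^2},\ \ldots,\ \frac{k!\,S_k}{(\log n)^{k-m+1}}\right)$$ converges in distribution to $X\cdot(1,1,\ldots,1)$ (a vector of length $k-m+1$), where $X\sim\mathrm{Exp}\left(\frac{1}{(m-1)!}\right)$.
   Context: Coupon collector problem: there are $n$ types of coupons. Coupons are collected one at a time; each collected coupon is, independently of the others, of each given type with probability $1/n$. Fix a positive integer $m$. One keeps collecting until at least $m$ copies of every one of the $n$ types have been collected, and then stops. For an integer $i\ge m$, a type of coupon is called an $i$-ton if exactly $i$ copies of it have been collected at the stopping time, and $S_i$ (which depends on $n$ and $m$) denotes the number of types that are $i$-tons; all the $S_i$ refer to the same collection process. $\mathbb{N}$ denotes the positive integers and $\log$ the natural logarithm. $\mathrm{Exp}(\lambda)$ denotes the exponential distribution with rate $\lambda$, i.e. with cumulative distribution function $r\mapsto 1-e^{-\lambda r}$ for $r\ge 0$. *)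

theory Defs
  imports "HOL-Probability.Probability"
begin

definition copies :: "(nat \<Rightarrow> nat) \<Rightarrow> nat \<Rightarrow> nat \<Rightarrow> nat" where
  "copies c t j = card {s. s < t \<and> c s = j}"

text \<open>The types are \<open>0, \<dots>, n - 1\<close>, and \<open>c s\<close> is the type of the coupon drawn at step \<open>s\<close>.
  On outcomes where the collection never completes (a null event) the \<open>LEAST\<close> is an
  arbitrary fixed number.\<close>

definition collection_time :: "nat \<Rightarrow> nat \<Rightarrow> (nat \<Rightarrow> nat) \<Rightarrow> nat" where
  "collection_time n m c = (LEAST t. \<forall>j<n. m \<le> copies c t j)"

definition num_tons :: "nat \<Rightarrow> nat \<Rightarrow> nat \<Rightarrow> (nat \<Rightarrow> nat) \<Rightarrow> nat" where
  "num_tons n m i c = card {j. j < n \<and> copies c (collection_time n m c) j = i}"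

locale coupon_collection = prob_space M for M :: "'a measure" +
  fixes n :: nat and C :: "nat \<Rightarrow> 'a \<Rightarrow> nat"
  assumes indep: "indep_vars (\<lambda>_. count_space UNIV) C UNIV"
    and uniform: "\<And>t j. j < n \<Longrightarrow> prob {\<omega> \<in> space M. C t \<omega> = j} = 1 / real n"

text \<open>Weak convergence of measures tested against bounded continuous functions; the library's
  \<open>weak_conv\<close> and \<open>weak_conv_m\<close> only cover measures on the real line.  The intended use is for
  measures on a \<open>\<sigma>\<close>-algebra for which every \<open>T\<close>-continuous function is measurable.  For a
  finite \<open>I\<close>, the space of real vectors indexed by \<open>I\<close> is \<open>I \<rightarrow>\<^sub>E UNIV\<close>, with the topology
  \<open>product_topology (\<lambda>_. euclideanreal) I\<close> and the \<open>\<sigma>\<close>-algebra of \<open>PiM I (\<lambda>_. borel)\<close>.\<close>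

definition weak_conv_on ::
    "'a topology \<Rightarrow> (nat \<Rightarrow> 'a measure) \<Rightarrow> 'a measure \<Rightarrow> bool" where
  "weak_conv_on T \<mu> \<nu> \<longleftrightarrow>
     (\<forall>f::'a \<Rightarrow> real. continuous_map T euclideanreal f \<and> bounded (f ` topspace T) \<longrightarrow>
        (\<lambda>n. \<integral>x. f x \<partial>\<mu> n) \<longlonglongrightarrow> (\<integral>x. f x \<partial>\<nu>))"

definition conv_in_distribution_vec ::
    "'i set \<Rightarrow> (nat \<Rightarrow> 'a measure) \<Rightarrow> (nat \<Rightarrow> 'a \<Rightarrow> 'i \<Rightarrow> real) \<Rightarrow> 'b measure \<Rightarrow> ('b \<Rightarrow> 'i \<Rightarrow> real) \<Rightarrow> bool"
  where
  "conv_in_distribution_vec I M Y N Z \<longleftrightarrow>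
     weak_conv_on (product_topology (\<lambda>_. euclideanreal) I)
       (\<lambda>n. distr (M n) (PiM I (\<lambda>_. borel)) (Y n)) (distr N (PiM I (\<lambda>_. borel)) Z)"

end

theory Submission
  imports Defs "HOL-Computational_Algebra.Polynomial" "HOL-Real_Asymp.Real_Asymp"
begin

text \<open>The proof looks at the number of types with \<^emph>\<open>at most\<close> \<open>i\<close> copies after \<open>t\<close> draws
(\<open>few_types\<close>). Unlike the number of types with exactly \<open>i\<close> copies, it decreases in \<open>t\<close>, so
its value at the random completion time \<open>T\<close> is controlled by its values at finitely many deterministic
times.

The right clock is \<open>deficit m n t = n (ln n)^(m - 1) exp (- t / n)\<close>. At times \<open>t n\<close> with
\<open>deficit m n (t n) \<longlonglongrightarrow> y > 0\<close>, a given type has about a Poisson number of copies with mean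
\<open>t n / n\<close>, which is about \<open>ln n\<close>; hence about \<open>y (ln n)^(i - m + 1) / i!\<close> types have exactly
\<open>i\<close> copies, and lower counts contribute only lower powers of \<open>ln n\<close>. The exact multinomial law of
the counts of \<open>r\<close> given types turns this into the limit of all factorial moments of
\<open>few_types\<close> (\<open>factorial_moment_asymptotics\<close>). Two consequences are drawn from it.

\<^item> For \<open>i = m - 1\<close> the factorial moments are asymptotically those of a Poisson variable of mean
  \<open>y / (m - 1)!\<close>, so by the Bonferroni inequalities the collection is complete at time \<open>t n\<close> with
  probability tending to \<open>exp (- y / (m - 1)!)\<close> (\<open>prob_none_few\<close>). In other words
  \<open>W = deficit m n T\<close> converges in distribution to the exponential law of rate \<open>1 / (m - 1)!\<close>
  (\<open>deficit_at_collection_time_cdf\<close>).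

\<^item> For \<open>i \<ge> m\<close> the mean grows and the first two factorial moments suffice: by Chebyshev's argument
  \<open>i! few_types / (ln n)^(i - m + 1)\<close> is close to \<open>y\<close> with probability tending to one
  (\<open>few_concentrates\<close>).

Applying the second fact on a fine finite grid of values \<open>y\<close> and using monotonicity, the rescaled number
of types with at most \<open>i\<close> copies at time \<open>T\<close> is close to \<open>W\<close> for all \<open>i\<close> at once. Passing
from at most \<open>i\<close> to exactly \<open>i\<close> copies subtracts the count for \<open>i - 1\<close>, which is smaller by a factor
\<open>ln n\<close>, or is zero if \<open>i = m\<close> (\<open>scaled_tons_close_in_probability\<close>). All coordinates of the
random vector are thus close to the single variable \<open>W\<close>, and a Slutsky argument
(\<open>conv_in_distribution_vec_diagonal\<close>) transfers the limit law of \<open>W\<close> to the diagonal.\<close>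

section \<open>The joint law of the numbers of copies of several types\<close>

lemma copies_0 [simp]: "copies c 0 j = 0"
  by (simp add: copies_def)

lemma copies_Suc: "copies c (Suc t) j = copies c t j + of_bool (c t = j)"
proof -
  have "{s. s < Suc t \<and> c s = j} = {s. s < t \<and> c s = j} \<union> (if c t = j then {t} else {})"
    by (auto simp: less_Suc_eq)
  then show ?thesis
    by (simp add: copies_def)
qed

lemma copies_mono: "s \<le> t \<Longrightarrow> copies c s j \<le> copies c t j"
  unfolding copies_def by (rule card_mono) auto

lemma copies_cong: "(\<And>s. s < t \<Longrightarrow> c s = d s) \<Longrightarrow> copies c t j = copies d t j"
  unfolding copies_def by (rule arg_cong[of _ _ card]) auto

definition multinomial_coeff :: "'i set \<Rightarrow> ('i \<Rightarrow> nat) \<Rightarrow> real" where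
  "multinomial_coeff A a = fact (sum a A) / (\<Prod>j\<in>A. fact (a j))"

text \<open>Multiplying out, the summand for \<open>j\<close> is the multinomial coefficient of \<open>a\<close> times
\<open>a j / sum a A\<close>, and these fractions add up to one.\<close>

lemma multinomial_coeff_Pascal:
  assumes A: "finite A" and pos: "0 < sum a A"
  shows "(\<Sum>j\<in>{j\<in>A. 0 < a j}. multinomial_coeff A (a(j := a j - 1))) = multinomial_coeff A a"
proof -
  define P where "P = (\<Prod>j\<in>A. fact (a j) :: real)"
  have P: "P > 0"
    by (simp add: P_def prod_pos)
  have eq: "multinomial_coeff A (a(j := a j - 1)) = fact (sum a A - 1) / P * real (a j)"
    if j: "j \<in> A" "0 < a j" for j
  proof -
    have s: "sum (a(j := a j - 1)) A = sum a A - 1"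
      using A j by (simp add: sum.remove[of A j] cong: sum.cong_simp)
    have "P = fact (a j) * (\<Prod>i\<in>A - {j}. fact (a i))"
      unfolding P_def using A j by (simp add: prod.remove)
    also have "fact (a j) = real (a j) * (fact (a j - 1) :: real)"
      using j fact_reduce[of "a j", where 'a = real] by simp
    also have "real (a j) * fact (a j - 1) * (\<Prod>i\<in>A - {j}. fact (a i) :: real)
        = real (a j) * (\<Prod>i\<in>A. fact ((a(j := a j - 1)) i))"
      using A j by (simp add: prod.remove[of A j] cong: prod.cong_simp)
    finally have "(\<Prod>i\<in>A. fact ((a(j := a j - 1)) i) :: real) = P / real (a j)"
      using j by simp
    then show ?thesis
      unfolding multinomial_coeff_def s by simp
  qed
  have "(\<Sum>j\<in>{j\<in>A. 0 < a j}. multinomial_coeff A (a(j := a j - 1)))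
      = (\<Sum>j\<in>{j\<in>A. 0 < a j}. fact (sum a A - 1) / P * real (a j))"
    using eq by (intro sum.cong) auto
  also have "\<dots> = fact (sum a A - 1) / P * real (\<Sum>j\<in>{j\<in>A. 0 < a j}. a j)"
    by (simp add: sum_distrib_left)
  also have "(\<Sum>j\<in>{j\<in>A. 0 < a j}. a j) = sum a A"
    using A by (intro sum.mono_neutral_left) auto
  also have "fact (sum a A - 1) / P * real (sum a A) = fact (sum a A) / P"
    using pos fact_reduce[of "sum a A", where 'a = real] by simp
  finally show ?thesis
    by (simp add: multinomial_coeff_def P_def)
qed

text \<open>The probability that exactly \<open>s\<close> of \<open>t\<close> draws hit a given set of \<open>r\<close> types out of \<open>n\<close>, and
that the \<open>s\<close> hits follow a prescribed sequence of types.\<close>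

definition count_weight :: "nat \<Rightarrow> nat \<Rightarrow> nat \<Rightarrow> nat \<Rightarrow> real" where
  "count_weight n r t s = (t choose s) * (1 / real n) ^ s * (1 - real r / real n) ^ (t - s)"

lemma count_weight_0_Suc: "count_weight n r (Suc t) 0 = (1 - real r / real n) * count_weight n r t 0"
  by (simp add: count_weight_def)

text \<open>Pascal's rule for the position of the last draw. Truncated subtraction in the exponent \<open>t - s\<close> is harmless
because the binomial coefficient vanishes for \<open>t < s\<close>.\<close>

lemma count_weight_Suc:
  "count_weight n r (Suc t) (Suc s) =
    (1 - real r / real n) * count_weight n r t (Suc s) + 1 / real n * count_weight n r t s"
proof -
  define p q where "p = 1 / real n" and "q = 1 - real r / real n"
  have w: "count_weight n r t s = (t choose s) * p ^ s * q ^ (t - s)" for t s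
    by (simp add: count_weight_def p_def q_def)
  consider "Suc s \<le> t" | "t = s" | "t < s" by linarith
  then show ?thesis
  proof cases
    case 1
    then have "t - s = Suc (t - Suc s)" by simp
    then show ?thesis
      unfolding w p_def[symmetric] q_def[symmetric] by (simp add: algebra_simps)
  qed (simp_all add: w binomial_eq_0 flip: p_def q_def)
qed

context coupon_collection
begin

lemma measurable_draw [measurable]: "C t \<in> measurable M (count_space UNIV)"
  using indep by (auto simp: indep_vars_def)

lemma measurable_draw_in [measurable]: "Measurable.pred M (\<lambda>\<omega>. C t \<omega> \<in> B)"
  by (rule measurable_compose[OF measurable_draw]) simp

lemma measurable_copies [measurable]:
  "(\<lambda>\<omega>. copies (\<lambda>s. C s \<omega>) t j) \<in> measurable M (count_space UNIV)"
  by (induction t) (simp_all add: copies_Suc)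

text \<open>The restriction of the draws to the first \<open>t\<close> steps is independent of the draw at step \<open>t\<close>; since it
takes values in a discrete space, every property of it is an event.\<close>

lemma prob_past_and_draw:
  assumes past: "\<And>c d. (\<And>s. s < t \<Longrightarrow> c s = d s) \<Longrightarrow> E c \<longleftrightarrow> E d"
  shows "prob {\<omega> \<in> space M. E (\<lambda>s. C s \<omega>) \<and> C t \<omega> \<in> B} =
    prob {\<omega> \<in> space M. E (\<lambda>s. C s \<omega>)} * prob {\<omega> \<in> space M. C t \<omega> \<in> B}"
proof -
  have PiM: "PiM A (\<lambda>_. count_space (UNIV :: nat set)) = count_space (PiE A (\<lambda>_. UNIV))"
    if "finite A" for A :: "nat set"
    using that by (intro count_space_PiM_finite) auto
  have ind: "indep_var (PiM {..<t} (\<lambda>_. count_space UNIV)) (\<lambda>\<omega>. \<lambda>s\<in>{..<t}. C s \<omega>)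
      (PiM {t} (\<lambda>_. count_space UNIV)) (\<lambda>\<omega>. \<lambda>s\<in>{t}. C s \<omega>)"
    by (rule indep_var_restrict[OF indep]) auto
  have E: "E (\<lambda>s. C s \<omega>) \<longleftrightarrow> E (\<lambda>s\<in>{..<t}. C s \<omega>)" for \<omega>
    by (rule past) auto
  have "prob ((\<lambda>\<omega>. (\<lambda>s\<in>{..<t}. C s \<omega>, \<lambda>s\<in>{t}. C s \<omega>)) -`
        ({c \<in> PiE {..<t} (\<lambda>_. UNIV). E c} \<times> {c \<in> PiE {t} (\<lambda>_. UNIV). c t \<in> B}) \<inter> space M)
      = prob ((\<lambda>\<omega>. \<lambda>s\<in>{..<t}. C s \<omega>) -` {c \<in> PiE {..<t} (\<lambda>_. UNIV). E c} \<inter> space M) *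
        prob ((\<lambda>\<omega>. \<lambda>s\<in>{t}. C s \<omega>) -` {c \<in> PiE {t} (\<lambda>_. UNIV). c t \<in> B} \<inter> space M)"
    by (rule indep_varD[OF ind]) (auto simp: PiM)
  moreover have "(\<lambda>\<omega>. (\<lambda>s\<in>{..<t}. C s \<omega>, \<lambda>s\<in>{t}. C s \<omega>)) -`
        ({c \<in> PiE {..<t} (\<lambda>_. UNIV). E c} \<times> {c \<in> PiE {t} (\<lambda>_. UNIV). c t \<in> B}) \<inter> space M
      = {\<omega> \<in> space M. E (\<lambda>s. C s \<omega>) \<and> C t \<omega> \<in> B}"
    using E by auto
  moreover have "(\<lambda>\<omega>. \<lambda>s\<in>{..<t}. C s \<omega>) -` {c \<in> PiE {..<t} (\<lambda>_. UNIV). E c} \<inter> space M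
      = {\<omega> \<in> space M. E (\<lambda>s. C s \<omega>)}"
    using E by auto
  moreover have "(\<lambda>\<omega>. \<lambda>s\<in>{t}. C s \<omega>) -` {c \<in> PiE {t} (\<lambda>_. UNIV). c t \<in> B} \<inter> space M
      = {\<omega> \<in> space M. C t \<omega> \<in> B}"
    by auto
  ultimately show ?thesis by simp
qed

lemma prob_draw_in:
  assumes A: "A \<subseteq> {..<n}"
  shows "prob {\<omega> \<in> space M. C t \<omega> \<in> A} = real (card A) / real n"
proof -
  have fin: "finite A" using A finite_subset by blast
  have "prob {\<omega> \<in> space M. C t \<omega> \<in> A} = prob (\<Union>j\<in>A. {\<omega> \<in> space M. C t \<omega> = j})"
    by (rule arg_cong[of _ _ prob]) auto
  also have "\<dots> = (\<Sum>j\<in>A. prob {\<omega> \<in> space M. C t \<omega> = j})"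
    using fin by (intro finite_measure_finite_Union) (auto simp: disjoint_family_on_def)
  also have "\<dots> = (\<Sum>j\<in>A. 1 / real n)"
    using A by (intro sum.cong) (auto simp: uniform)
  finally show ?thesis by simp
qed

lemma prob_draw_notin:
  assumes A: "A \<subseteq> {..<n}"
  shows "prob {\<omega> \<in> space M. C t \<omega> \<in> - A} = 1 - real (card A) / real n"
proof -
  have "{\<omega> \<in> space M. C t \<omega> \<in> - A} = space M - {\<omega> \<in> space M. C t \<omega> \<in> A}" by auto
  then show ?thesis
    by (simp add: prob_compl prob_draw_in[OF A])
qed

text \<open>The multinomial law, by induction on the number of draws. The recursion obtained by conditioning on the last draw
is satisfied by the right-hand side because of the Pascal rules for its two factors.\<close>

lemma prob_copies_eq:
  assumes A: "A \<subseteq> {..<n}"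
  shows "prob {\<omega> \<in> space M. \<forall>j\<in>A. copies (\<lambda>s. C s \<omega>) t j = a j} =
    multinomial_coeff A a * count_weight n (card A) t (sum a A)"
proof (induction t arbitrary: a)
  case 0
  have fin: "finite A" using A finite_subset by blast
  show ?case
  proof (cases "\<forall>j\<in>A. a j = 0")
    case True
    then have "{\<omega> \<in> space M. \<forall>j\<in>A. copies (\<lambda>s. C s \<omega>) 0 j = a j} = space M"
      by auto
    moreover have "sum a A = 0" using True by simp
    ultimately show ?thesis
      using True by (simp add: prob_space multinomial_coeff_def count_weight_def)
  next
    case False
    then have *: "{\<omega> \<in> space M. \<forall>j\<in>A. copies (\<lambda>s. C s \<omega>) 0 j = a j} = {}"
      by auto
    have "0 < sum a A" using False fin by (meson neq0_conv sum_eq_0_iff)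
    then show ?thesis
      unfolding * by (simp add: count_weight_def)
  qed
next
  case (Suc t)
  have fin: "finite A" using A finite_subset by blast
  define E where "E = (\<lambda>a c. \<forall>j\<in>A. copies c t j = a j)"
  have E_past: "E a c \<longleftrightarrow> E a d" if "\<And>s. s < t \<Longrightarrow> c s = d s" for a c d
    using copies_cong[OF that, of t] by (simp add: E_def)
  have [measurable]: "Measurable.pred M (\<lambda>\<omega>. E a (\<lambda>s. C s \<omega>))" for a
    unfolding E_def using fin by measurable
  define miss where "miss = {\<omega> \<in> space M. E a (\<lambda>s. C s \<omega>) \<and> C t \<omega> \<in> - A}"
  define hit where
    "hit = (\<lambda>j. {\<omega> \<in> space M. E (a(j := a j - 1)) (\<lambda>s. C s \<omega>) \<and> C t \<omega> \<in> {j}})"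
  define A' where "A' = {j\<in>A. 0 < a j}"
  have [measurable]: "miss \<in> events" "hit j \<in> events" for j
    unfolding miss_def hit_def by measurable
  \<comment> \<open>The last draw either misses \<open>A\<close> or is the last copy of some type in \<open>A\<close>.\<close>
  have split: "{\<omega> \<in> space M. \<forall>j\<in>A. copies (\<lambda>s. C s \<omega>) (Suc t) j = a j} =
      miss \<union> (\<Union>j\<in>A'. hit j)" (is "?L = ?R")
  proof (intro set_eqI iffI)
    fix \<omega> assume \<omega>: "\<omega> \<in> ?L"
    show "\<omega> \<in> ?R"
    proof (cases "C t \<omega> \<in> A")
      case True
      then have "\<omega> \<in> hit (C t \<omega>)" "C t \<omega> \<in> A'"
        using \<omega> by (auto simp: hit_def E_def A'_def copies_Suc split: if_splits)
      then show ?thesis by blast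
    next
      case False
      then have "copies (\<lambda>s. C s \<omega>) (Suc t) j = copies (\<lambda>s. C s \<omega>) t j" if "j \<in> A" for j
        using that by (auto simp: copies_Suc)
      then show ?thesis
        using \<omega> False by (auto simp: miss_def E_def)
    qed
  next
    fix \<omega> assume "\<omega> \<in> ?R"
    then consider "\<omega> \<in> miss" | j where "j \<in> A'" "\<omega> \<in> hit j" by blast
    then show "\<omega> \<in> ?L"
    proof cases
      case 1
      then show ?thesis
        by (auto simp: miss_def E_def copies_Suc)
    next
      case 2
      then show ?thesis
        by (auto simp: hit_def E_def A'_def copies_Suc)
    qed
  qed
  have p_miss: "prob miss = multinomial_coeff A a *
      ((1 - real (card A) / real n) * count_weight n (card A) t (sum a A))"
  proof -
    have "prob miss = prob {\<omega> \<in> space M. E a (\<lambda>s. C s \<omega>)} * prob {\<omega> \<in> space M. C t \<omega> \<in> - A}"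
      unfolding miss_def by (rule prob_past_and_draw) (rule E_past)
    then show ?thesis
      using Suc.IH[of a] by (simp only: prob_draw_notin[OF A] E_def mult_ac)
  qed
  have p_hit: "prob (hit j) = multinomial_coeff A (a(j := a j - 1)) *
      (1 / real n * count_weight n (card A) t (sum a A - 1))" if "j \<in> A'" for j
  proof -
    have j: "j \<in> A" "0 < a j" using that by (auto simp: A'_def)
    then have "{j} \<subseteq> {..<n}" using A by auto
    then have "prob {\<omega> \<in> space M. C t \<omega> \<in> {j}} = 1 / real n"
      by (subst prob_draw_in) auto
    moreover have s: "sum (a(j := a j - 1)) A = sum a A - 1"
      using fin j by (simp add: sum.remove[of A j] cong: sum.cong_simp)
    moreover have "prob (hit j) = prob {\<omega> \<in> space M. E (a(j := a j - 1)) (\<lambda>s. C s \<omega>)} *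
        prob {\<omega> \<in> space M. C t \<omega> \<in> {j}}"
      unfolding hit_def by (rule prob_past_and_draw) (rule E_past)
    ultimately show ?thesis
      using Suc.IH[of "a(j := a j - 1)"] by (simp only: E_def s mult_ac)
  qed
  have "prob (miss \<union> (\<Union>j\<in>A'. hit j)) = prob miss + prob (\<Union>j\<in>A'. hit j)"
    using fin by (intro finite_measure_Union)
      (auto simp: A'_def miss_def hit_def intro!: sets.finite_UN)
  also have "prob (\<Union>j\<in>A'. hit j) = (\<Sum>j\<in>A'. prob (hit j))"
    using fin by (intro finite_measure_finite_Union)
      (auto simp: A'_def hit_def disjoint_family_on_def)
  also have "\<dots> = (\<Sum>j\<in>A'. multinomial_coeff A (a(j := a j - 1))) *
      (1 / real n * count_weight n (card A) t (sum a A - 1))"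
    unfolding sum_distrib_right by (intro sum.cong refl p_hit)
  finally have total: "prob (miss \<union> (\<Union>j\<in>A'. hit j)) = prob miss +
      (\<Sum>j\<in>A'. multinomial_coeff A (a(j := a j - 1))) *
      (1 / real n * count_weight n (card A) t (sum a A - 1))" .
  show ?case
  proof (cases "sum a A")
    case 0
    then have "A' = {}" using fin by (auto simp: A'_def)
    then show ?thesis
      unfolding split total p_miss using 0 by (simp add: count_weight_0_Suc)
  next
    case s: (Suc s)
    have "(\<Sum>j\<in>A'. multinomial_coeff A (a(j := a j - 1))) = multinomial_coeff A a"
      unfolding A'_def using fin s by (intro multinomial_coeff_Pascal) auto
    then show ?thesis
      unfolding split total p_miss using s by (simp add: count_weight_Suc distrib_left)
  qed
qed

end

text \<open>The truncated exponential series. The coefficient of \<open>x^s\<close> in its \<open>r\<close>-th power is the sum of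
\<open>1 / (a\<^sub>1! \<dots> a\<^sub>r!)\<close> over all count vectors with entries at most \<open>i\<close> and sum \<open>s\<close>. It collects the
multinomial law into a form that depends on the set of types only through its size.\<close>

definition trunc_exp_poly :: "nat \<Rightarrow> real poly" where
  "trunc_exp_poly i = (\<Sum>b\<le>i. monom (1 / fact b) b)"

lemma coeff_trunc_exp_poly_top: "coeff (trunc_exp_poly i) i = 1 / fact i"
  by (simp add: trunc_exp_poly_def coeff_sum)

lemma degree_trunc_exp_poly: "degree (trunc_exp_poly i) = i"
proof (rule antisym)
  show "degree (trunc_exp_poly i) \<le> i"
    unfolding trunc_exp_poly_def
    by (intro degree_sum_le) (auto intro: order_trans[OF degree_monom_le])
  show "i \<le> degree (trunc_exp_poly i)"
    by (rule le_degree) (simp add: coeff_trunc_exp_poly_top)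
qed

lemma coeff_power_trunc_exp_poly_top:
  "coeff (trunc_exp_poly i ^ r) (r * i) = (1 / fact i) ^ r"
proof -
  have "trunc_exp_poly i \<noteq> 0"
    using coeff_trunc_exp_poly_top[of i] by auto
  then have "degree (trunc_exp_poly i ^ r) = r * i"
    by (simp add: degree_power_eq degree_trunc_exp_poly)
  then show ?thesis
    using lead_coeff_power[of "trunc_exp_poly i" r]
    by (simp add: degree_trunc_exp_poly coeff_trunc_exp_poly_top)
qed

context coupon_collection
begin

text \<open>Summing the multinomial law over all admissible count vectors and grouping them by their sum.\<close>

lemma prob_copies_le:
  assumes A: "A \<subseteq> {..<n}"
  shows "prob {\<omega> \<in> space M. \<forall>j\<in>A. copies (\<lambda>s. C s \<omega>) t j \<le> i} =
    (\<Sum>s\<le>card A * i. coeff (trunc_exp_poly i ^ card A) s * (fact s * count_weight n (card A) t s))"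
proof -
  have fin: "finite A" using A finite_subset by blast
  define R where "R = PiE A (\<lambda>_. {..i})"
  define E where "E = (\<lambda>a. {\<omega> \<in> space M. \<forall>j\<in>A. copies (\<lambda>s. C s \<omega>) t j = a j})"
  have finR: "finite R" unfolding R_def using fin by (intro finite_PiE) auto
  have "{\<omega> \<in> space M. \<forall>j\<in>A. copies (\<lambda>s. C s \<omega>) t j \<le> i} = (\<Union>a\<in>R. E a)" (is "?L = _")
  proof (intro equalityI subsetI)
    fix \<omega> assume "\<omega> \<in> ?L"
    then have "(\<lambda>j\<in>A. copies (\<lambda>s. C s \<omega>) t j) \<in> R" "\<omega> \<in> E (\<lambda>j\<in>A. copies (\<lambda>s. C s \<omega>) t j)"
      by (auto simp: R_def E_def)
    then show "\<omega> \<in> (\<Union>a\<in>R. E a)" by blast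
  qed (auto simp: R_def E_def PiE_iff)
  moreover have "prob (\<Union>a\<in>R. E a) = (\<Sum>a\<in>R. prob (E a))"
  proof (rule finite_measure_finite_Union[OF finR])
    show "E ` R \<subseteq> events" unfolding E_def using fin by (auto intro!: measurable_sets)
    show "disjoint_family_on E R"
      by (auto simp: disjoint_family_on_def E_def R_def) (metis PiE_ext)
  qed
  moreover have "(\<Sum>a\<in>R. prob (E a)) =
      (\<Sum>a\<in>R. multinomial_coeff A a * count_weight n (card A) t (sum a A))"
    by (simp add: E_def prob_copies_eq[OF A])
  ultimately have lhs: "prob {\<omega> \<in> space M. \<forall>j\<in>A. copies (\<lambda>s. C s \<omega>) t j \<le> i} =
      (\<Sum>a\<in>R. multinomial_coeff A a * count_weight n (card A) t (sum a A))"
    by simp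
  have "trunc_exp_poly i ^ card A =
      (\<Sum>a\<in>R. monom (1 / (\<Prod>j\<in>A. fact (a j))) (sum a A))"
  proof -
    have mono: "(\<Prod>j\<in>B. monom (1 / fact (a j)) (a j)) = monom (1 / (\<Prod>j\<in>B. fact (a j) :: real)) (sum a B)"
      if "finite B" for a :: "nat \<Rightarrow> nat" and B
      using that by (induction B) (simp_all add: mult_monom)
    have "trunc_exp_poly i ^ card A = (\<Prod>j\<in>A. \<Sum>b\<le>i. monom (1 / fact b) b)"
      by (simp add: trunc_exp_poly_def)
    also have "\<dots> = (\<Sum>a\<in>R. \<Prod>j\<in>A. monom (1 / fact (a j)) (a j))"
      unfolding R_def by (rule prod_sum_PiE) (use fin in auto)
    finally show ?thesis by (simp add: mono[OF fin])
  qed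
  then have "(\<Sum>s\<le>card A * i. coeff (trunc_exp_poly i ^ card A) s * (fact s * count_weight n (card A) t s))
      = (\<Sum>s\<le>card A * i. \<Sum>a\<in>R. (if sum a A = s then 1 / (\<Prod>j\<in>A. fact (a j)) else 0) *
          (fact s * count_weight n (card A) t s))"
    by (simp add: coeff_sum sum_distrib_right)
  also have "\<dots> = (\<Sum>a\<in>R. \<Sum>s\<le>card A * i. if s = sum a A then
        1 / (\<Prod>j\<in>A. fact (a j)) * (fact s * count_weight n (card A) t s) else 0)"
    by (subst sum.swap) (intro sum.cong refl, auto)
  also have "\<dots> = (\<Sum>a\<in>R. multinomial_coeff A a * count_weight n (card A) t (sum a A))"
  proof (intro sum.cong refl)
    fix a assume "a \<in> R"
    then have "sum a A \<le> card A * i"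
      using sum_bounded_above[of A a i] by (auto simp: R_def PiE_iff)
    then show "(\<Sum>s\<le>card A * i. if s = sum a A then
        1 / (\<Prod>j\<in>A. fact (a j)) * (fact s * count_weight n (card A) t s) else 0) =
        multinomial_coeff A a * count_weight n (card A) t (sum a A)"
      by (simp add: multinomial_coeff_def)
  qed
  finally show ?thesis
    using lhs by simp
qed
end

section \<open>The time scale of completion\<close>

text \<open>A falling factorial of fixed length is asymptotically a power.\<close>

lemma binomial_asymptotics:
  "(\<lambda>n. fact r * real (n choose r) / real n ^ r) \<longlonglongrightarrow> 1"
proof (induction r)
  case (Suc r)
  have "(\<lambda>n. fact r * real (n choose r) / real n ^ r * ((real n - real r) / real n)) \<longlonglongrightarrow> 1 * 1"
    by (intro tendsto_mult Suc) real_asymp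
  moreover have "fact r * real (n choose r) / real n ^ r * ((real n - real r) / real n) =
      fact (Suc r) * real (n choose Suc r) / real n ^ Suc r" for n
  proof -
    have "real (Suc r) * real (n choose Suc r) = (real n - real r) * real (n choose r)"
    proof (cases "r \<le> n")
      case True
      have "Suc r * (n choose Suc r) = (n - r) * (n choose r)"
        by (metis binomial_absorb_comp binomial_absorption)
      then show ?thesis
        using True by (metis of_nat_diff of_nat_mult)
    qed (simp add: binomial_eq_0)
    then have "fact (Suc r) * real (n choose Suc r) = fact r * ((real n - real r) * real (n choose r))"
      by (simp only: fact_Suc ac_simps)
    then show ?thesis
      by (simp only: power_Suc times_divide_times_eq ac_simps)
  qed
  ultimately show ?case by simp
qed simp

text \<open>Up to the factor \<open>1 / (m - 1)!\<close> this approximates the expected number of types that still miss copies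
after \<open>t\<close> draws, for \<open>t\<close> near \<open>n ln n\<close>. It serves as a decreasing reparametrisation of time on which the limits below become
non-degenerate.\<close>

definition deficit :: "nat \<Rightarrow> nat \<Rightarrow> nat \<Rightarrow> real" where
  "deficit m n t = real n * ln (real n) ^ (m - 1) * exp (- real t / real n)"

lemma deficit_antimono: "s \<le> t \<Longrightarrow> deficit m n t \<le> deficit m n s"
proof (cases "n = 0")
  case False
  assume "s \<le> t"
  then show ?thesis
    using False unfolding deficit_def by (intro mult_left_mono) (auto simp: field_simps)
qed (simp add: deficit_def)

lemma deficit_pos: "3 \<le> n \<Longrightarrow> 0 < deficit m n t"
  by (simp add: deficit_def)

text \<open>The level \<open>y\<close> is crossed between two consecutive integer times, and \<open>deficit\<close> changes by a factor
\<open>exp (1 / n)\<close> per step, so its value just before the crossing tends to \<open>y\<close>. With the last time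
before the crossing, \<open>deficit m n T \<le> y\<close> becomes the strict inequality \<open>t n < T\<close> for integers
\<open>T\<close>.\<close>

lemma exists_threshold_time:
  assumes y: "0 < y"
  obtains t where "(\<lambda>n. deficit m n (t n)) \<longlonglongrightarrow> y"
    and "\<forall>\<^sub>F n in sequentially. \<forall>T. deficit m n T \<le> y \<longleftrightarrow> t n < T"
proof -
  define u where "u = (\<lambda>n. LEAST T. deficit m n T \<le> y)"
  have u: "deficit m n (u n) \<le> y" if n: "3 \<le> n" for n
  proof -
    have "((\<lambda>T. deficit m n T) \<longlongrightarrow> 0) sequentially"
    proof -
      have "(\<lambda>T. exp (- real T / real n)) \<longlonglongrightarrow> 0"
        using n by real_asymp
      from tendsto_mult_right[OF this, of "real n * ln (real n) ^ (m - 1)"] show ?thesis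
        by (simp add: deficit_def mult_ac)
    qed
    then have "\<forall>\<^sub>F T in sequentially. deficit m n T < y"
      using y by (auto intro: order_tendstoD)
    then obtain T where "deficit m n T \<le> y"
      by (auto simp: eventually_sequentially intro: less_imp_le)
    then show ?thesis
      unfolding u_def by (rule LeastI)
  qed
  have iff: "deficit m n T \<le> y \<longleftrightarrow> u n \<le> T" if "3 \<le> n" for n T
    using u[OF that] deficit_antimono[of "u n" T m n] unfolding u_def
    by (auto intro: Least_le order_trans)
\<comment> \<open>For large \<open>n\<close> the level \<open>y\<close> has not been reached at time zero, so there is a step before the crossing.\<close>
    have large: "\<forall>\<^sub>F n in sequentially. y < real n"
    using filterlim_real_sequentially by (simp add: filterlim_at_top_dense)
  have u_pos: "0 < u n" if n: "3 \<le> n" "y < real n" for n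
  proof (rule ccontr)
    assume "\<not> 0 < u n"
    then have "real n * ln (real n) ^ (m - 1) \<le> y"
      using u[OF n(1)] by (simp add: deficit_def)
    moreover have "1 \<le> ln (real n)"
      using exp_le n(1) by (subst ln_ge_iff) linarith+
    from mult_left_mono[OF one_le_power[OF this, of "m - 1"], of "real n"]
    have "real n \<le> real n * ln (real n) ^ (m - 1)"
      by simp
    ultimately show False using n(2) by linarith
  qed
  show ?thesis
  proof
    show "\<forall>\<^sub>F n in sequentially. \<forall>T. deficit m n T \<le> y \<longleftrightarrow> u n - 1 < T"
      using eventually_ge_at_top[of 3] large
    proof eventually_elim
      case (elim n)
      from elim have "0 < u n" by (rule u_pos)
      then have "u n \<le> T \<longleftrightarrow> u n - 1 < T" for T by linarith
      with iff[OF elim(1)] show ?case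
        by (intro allI) (rule trans)
    qed
    show "(\<lambda>n. deficit m n (u n - 1)) \<longlonglongrightarrow> y"
    proof (rule tendsto_sandwich)
      show "\<forall>\<^sub>F n in sequentially. y \<le> deficit m n (u n - 1)"
        using eventually_ge_at_top[of 3] large
      proof eventually_elim
        case (elim n)
        from elim have "0 < u n" by (rule u_pos)
        then have "\<not> u n \<le> u n - 1" by simp
        then show ?case by (simp only: iff[OF elim(1), symmetric])
      qed
      show "\<forall>\<^sub>F n in sequentially. deficit m n (u n - 1) \<le> y * exp (1 / real n)"
        using eventually_ge_at_top[of 3] large
      proof eventually_elim
        case (elim n)
        from elim have u_n: "0 < u n" by (rule u_pos)
        have "- (real (u n) - 1) / real n = - real (u n) / real n + 1 / real n"
          by (simp add: diff_divide_distrib)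
        then have "deficit m n (u n - 1) = deficit m n (u n) * exp (1 / real n)"
          using u_n by (simp add: deficit_def of_nat_diff diff_divide_distrib flip: exp_add)
        also have "\<dots> \<le> y * exp (1 / real n)"
          using u[OF elim(1)] by (intro mult_right_mono) simp_all
        finally show ?case .
      qed
      show "(\<lambda>n. y * exp (1 / real n)) \<longlonglongrightarrow> y"
        by real_asymp
    qed auto
  qed
qed

text \<open>Taking logarithms, \<open>t n / n = ln n + (m - 1) ln (ln n) - ln (deficit m n (t n))\<close>, and the first term
dominates.\<close>

lemma threshold_time_asymptotics:
  assumes lim: "(\<lambda>n. deficit m n (t n)) \<longlonglongrightarrow> y" and y: "0 < y"
  shows "(\<lambda>n. real (t n) / (real n * ln (real n))) \<longlonglongrightarrow> 1"
proof -
  have "(\<lambda>n. 1 + real (m - 1) * (ln (ln (real n)) / ln (real n)) -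
      ln (deficit m n (t n)) * (1 / ln (real n))) \<longlonglongrightarrow> 1 + real (m - 1) * 0 - ln y * 0"
  proof (intro tendsto_intros lim)
    show "(\<lambda>n. ln (ln (real n)) / ln (real n)) \<longlonglongrightarrow> 0"
      by real_asymp
    show "(\<lambda>n. 1 / ln (real n)) \<longlonglongrightarrow> 0"
      by real_asymp
  qed (use y in auto)
  moreover have "\<forall>\<^sub>F n in sequentially. 1 + real (m - 1) * (ln (ln (real n)) / ln (real n)) -
      ln (deficit m n (t n)) * (1 / ln (real n)) = real (t n) / (real n * ln (real n))"
    using eventually_ge_at_top[of 3]
  proof eventually_elim
    case (elim n)
    then have "1 < real n" "0 < ln (real n)" by auto
    then have "ln (deficit m n (t n)) = ln (real n) + real (m - 1) * ln (ln (real n)) - real (t n) / real n"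
      by (simp add: deficit_def ln_mult ln_realpow)
    then have "real (t n) / (real n * ln (real n)) =
        (ln (real n) + real (m - 1) * ln (ln (real n)) - ln (deficit m n (t n))) / ln (real n)"
      by simp
    then show ?case
      using \<open>0 < ln (real n)\<close> by (simp add: add_divide_distrib diff_divide_distrib)
  qed
  ultimately show ?thesis
    by (simp add: tendsto_cong)
qed

text \<open>Three approximations enter: \<open>(1 - r / n)^t\<close> by \<open>exp (- r t / n)\<close>, which is valid because
\<open>t / n\<^sup>2\<close> tends to zero; the falling factorial of \<open>t\<close> by \<open>t^s\<close>; and \<open>t / n\<close> by
\<open>ln n\<close>. What remains is the \<open>r\<close>-th power of \<open>deficit\<close>.\<close>

lemma count_weight_asymptotics:
  assumes lim: "(\<lambda>n. deficit m n (t n)) \<longlonglongrightarrow> y" and y: "0 < y"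
  shows "(\<lambda>n. (real n * ln (real n) ^ (m - 1)) ^ r * (fact s * count_weight n r (t n) s) / ln (real n) ^ s)
    \<longlonglongrightarrow> y ^ r"
proof -
  note t = threshold_time_asymptotics[OF lim y]
  have t_inf: "filterlim t at_top sequentially"
  proof -
    have "filterlim (\<lambda>n. real (t n) / (real n * ln (real n)) * (real n * ln (real n))) at_top sequentially"
      by (rule filterlim_tendsto_pos_mult_at_top[OF t]) (simp, real_asymp)
    moreover have "\<forall>\<^sub>F n in sequentially. real (t n) / (real n * ln (real n)) * (real n * ln (real n)) = real (t n)"
      using eventually_ge_at_top[of 3] by eventually_elim auto
    ultimately have "filterlim (\<lambda>n. real (t n)) at_top sequentially"
      by (simp cong: filterlim_cong)
    then show ?thesis
      by (simp add: filterlim_sequentially_iff_filterlim_real)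
  qed
  define q where "q = (\<lambda>n. 1 - real r / real n)"
  have q_pos: "\<forall>\<^sub>F n in sequentially. 0 < q n"
    unfolding q_def by real_asymp
\<comment> \<open>In the exponent, \<open>r + n ln (1 - r / n)\<close> is of order \<open>1 / n\<close>, which beats \<open>t n / n\<close>, of order \<open>ln n\<close>.\<close>
    have pow: "(\<lambda>n. exp (real r * (real (t n) / real n)) * q n ^ t n) \<longlonglongrightarrow> 1"
  proof -
    have "(\<lambda>n. exp (real (t n) / (real n * ln (real n)) *
        (ln (real n) * (real r + real n * ln (q n))))) \<longlonglongrightarrow> exp (1 * 0)"
      unfolding q_def by (intro tendsto_exp tendsto_mult t) real_asymp
    moreover have "\<forall>\<^sub>F n in sequentially. exp (real (t n) / (real n * ln (real n)) *
        (ln (real n) * (real r + real n * ln (q n)))) = exp (real r * (real (t n) / real n)) * q n ^ t n"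
      using eventually_ge_at_top[of 3] q_pos
    proof eventually_elim
      case (elim n)
      then have n: "0 < real n" "ln (real n) \<noteq> 0" by auto
      have "real (t n) / (real n * ln (real n)) * (ln (real n) * (real r + real n * ln (q n))) =
          real r * (real (t n) / real n) + real (t n) * ln (q n)"
        using n by (simp add: field_simps)
      then show ?case
        using elim(2) by (simp only: exp_add exp_of_nat_mult exp_ln)
    qed
    ultimately show ?thesis by (simp add: tendsto_cong)
  qed
  have "(\<lambda>n. deficit m n (t n) ^ r * (exp (real r * (real (t n) / real n)) * q n ^ t n) *
      (fact s * real (t n choose s) / real (t n) ^ s) * (real (t n) / (real n * ln (real n))) ^ s / q n ^ s)
      \<longlonglongrightarrow> y ^ r * 1 * 1 * 1 ^ s / 1 ^ s"
  proof (intro tendsto_intros lim pow t)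
    show "(\<lambda>n. fact s * real (t n choose s) / real (t n) ^ s) \<longlonglongrightarrow> 1"
      using filterlim_compose[OF binomial_asymptotics t_inf] .
    show "q \<longlonglongrightarrow> 1"
      unfolding q_def by real_asymp
  qed simp
  moreover have "\<forall>\<^sub>F n in sequentially. deficit m n (t n) ^ r * (exp (real r * (real (t n) / real n)) * q n ^ t n) *
      (fact s * real (t n choose s) / real (t n) ^ s) * (real (t n) / (real n * ln (real n))) ^ s / q n ^ s =
      (real n * ln (real n) ^ (m - 1)) ^ r * (fact s * count_weight n r (t n) s) / ln (real n) ^ s"
    using eventually_ge_at_top[of 3] q_pos filterlim_at_top[THEN iffD1, OF t_inf, rule_format, of "Suc s"]
  proof eventually_elim
    case (elim n)
    have e: "deficit m n (t n) ^ r * exp (real r * (real (t n) / real n)) = (real n * ln (real n) ^ (m - 1)) ^ r"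
      by (simp add: deficit_def power_mult_distrib exp_of_nat_mult flip: exp_minus power_mult_distrib)
        (simp add: power_mult_distrib flip: exp_add exp_of_nat_mult)
    have q: "q n ^ t n / q n ^ s = q n ^ (t n - s)"
      using elim by (simp add: power_diff)
    have "deficit m n (t n) ^ r * (exp (real r * (real (t n) / real n)) * q n ^ t n) *
      (fact s * real (t n choose s) / real (t n) ^ s) * (real (t n) / (real n * ln (real n))) ^ s / q n ^ s =
      (deficit m n (t n) ^ r * exp (real r * (real (t n) / real n))) * (q n ^ t n / q n ^ s) *
      (fact s * real (t n choose s) * ((real (t n) ^ s / real (t n) ^ s) * (1 / real n) ^ s) / ln (real n) ^ s)"
      by (simp add: power_divide power_mult_distrib ac_simps)
    also have "real (t n) ^ s / real (t n) ^ s = 1"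
      using elim by simp
    finally show ?case
      unfolding e q by (simp add: count_weight_def q_def)
  qed
  ultimately show ?thesis
    by (simp add: tendsto_cong)
qed

section \<open>Factorial moments of the number of types with few copies\<close>

definition few_types :: "nat \<Rightarrow> nat \<Rightarrow> (nat \<Rightarrow> nat) \<Rightarrow> nat \<Rightarrow> nat" where
  "few_types n i c t = card {j. j < n \<and> copies c t j \<le> i}"

lemma few_types_le: "few_types n i c t \<le> n"
proof -
  have "card {j. j < n \<and> copies c t j \<le> i} \<le> card {..<n}"
    by (rule card_mono) auto
  then show ?thesis by (simp add: few_types_def)
qed

lemma few_types_antimono: "s \<le> t \<Longrightarrow> few_types n i c t \<le> few_types n i c s"
  unfolding few_types_def by (rule card_mono) (auto intro: order_trans[OF copies_mono])

lemma few_types_split: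
  assumes "1 \<le> i"
  shows "few_types n i c t = few_types n (i - 1) c t + card {j. j < n \<and> copies c t j = i}"
proof -
  have "{j. j < n \<and> copies c t j \<le> i} =
      {j. j < n \<and> copies c t j \<le> i - 1} \<union> {j. j < n \<and> copies c t j = i}"
    using assms by auto
  moreover have "{j. j < n \<and> copies c t j \<le> i - 1} \<inter> {j. j < n \<and> copies c t j = i} = {}"
    using assms by auto
  ultimately show ?thesis
    by (simp add: few_types_def card_Un_disjoint)
qed

text \<open>By \<open>prob_copies_le\<close> this is the probability that \<open>r\<close> given types all have at most \<open>i\<close> copies.\<close>

definition few_prob :: "nat \<Rightarrow> nat \<Rightarrow> nat \<Rightarrow> nat \<Rightarrow> real" where
  "few_prob n i r t =
    (\<Sum>s\<le>r * i. coeff (trunc_exp_poly i ^ r) s * (fact s * count_weight n r t s))"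

text \<open>The term for total count \<open>s\<close> is of order \<open>(ln n)^s\<close>, so only \<open>s = r * i\<close> survives: in the limit
all \<open>r\<close> types have exactly \<open>i\<close> copies. The bound \<open>m \<le> i + 1\<close> includes \<open>i = m - 1\<close>, where
the power of \<open>ln n\<close> is one.\<close>

lemma few_prob_asymptotics:
  assumes lim: "(\<lambda>n. deficit m n (t n)) \<longlonglongrightarrow> y" and y: "0 < y"
    and m: "1 \<le> m" "m \<le> i + 1"
  shows "(\<lambda>n. real n ^ r * few_prob n i r (t n) / ln (real n) ^ (r * (i + 1 - m)))
    \<longlonglongrightarrow> (y / fact i) ^ r"
proof -
  define w where "w = (\<lambda>s n. (real n * ln (real n) ^ (m - 1)) ^ r *
    (fact s * count_weight n r (t n) s) / ln (real n) ^ s)"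
  define c where "c = coeff (trunc_exp_poly i ^ r)"
  have w: "w s \<longlonglongrightarrow> y ^ r" for s
    unfolding w_def by (rule count_weight_asymptotics[OF lim y])
  have ratio: "(\<lambda>n. 1 / ln (real n) ^ (r * i - s)) \<longlonglongrightarrow> of_bool (s = r * i)" if "s \<le> r * i" for s
  proof (cases "s = r * i")
    case False
    have "(\<lambda>n. (1 / ln (real n)) ^ (r * i - s)) \<longlonglongrightarrow> 0 ^ (r * i - s)"
      by (intro tendsto_power) real_asymp
    then show ?thesis
      using False that by (simp add: power_one_over power_0_left)
  qed simp
  have "(\<lambda>n. \<Sum>s\<le>r * i. c s * w s n * (1 / ln (real n) ^ (r * i - s)))
      \<longlonglongrightarrow> (\<Sum>s\<le>r * i. c s * y ^ r * of_bool (s = r * i))"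
    by (intro tendsto_sum tendsto_mult tendsto_const w ratio) auto
  also have "(\<Sum>s\<le>r * i. c s * y ^ r * of_bool (s = r * i)) = (\<Sum>s\<in>{r * i}. c s * y ^ r)"
    by (rule sum.mono_neutral_cong_right) auto
  also have "\<dots> = (y / fact i) ^ r"
    by (simp add: c_def coeff_power_trunc_exp_poly_top power_divide)
  finally have "(\<lambda>n. \<Sum>s\<le>r * i. c s * w s n * (1 / ln (real n) ^ (r * i - s)))
      \<longlonglongrightarrow> (y / fact i) ^ r" .
  moreover have "\<forall>\<^sub>F n in sequentially.
      (\<Sum>s\<le>r * i. c s * w s n * (1 / ln (real n) ^ (r * i - s))) =
      real n ^ r * few_prob n i r (t n) / ln (real n) ^ (r * (i + 1 - m))"
    using eventually_ge_at_top[of 3]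
  proof eventually_elim
    case (elim n)
    define l where "l = ln (real n)"
    have l: "l \<noteq> 0" using elim by (auto simp: l_def)
    have "c s * w s n * (1 / l ^ (r * i - s)) =
        real n ^ r * (c s * (fact s * count_weight n r (t n) s)) / l ^ (r * (i + 1 - m))"
      if s: "s \<le> r * i" for s
    proof -
      have ri: "r * i = (m - 1) * r + r * (i + 1 - m)"
        using m by (subst mult.commute[of "m - 1"], subst add_mult_distrib2[symmetric]) simp
      have "l ^ s * l ^ (r * i - s) = l ^ (r * i)"
        using s by (simp flip: power_add)
      also have "\<dots> = l ^ ((m - 1) * r + r * (i + 1 - m))"
        by (rule arg_cong[OF ri])
      also have "\<dots> = (l ^ (m - 1)) ^ r * l ^ (r * (i + 1 - m))"
        by (simp add: power_add power_mult)
      finally have e: "l ^ s * l ^ (r * i - s) = (l ^ (m - 1)) ^ r * l ^ (r * (i + 1 - m))" .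
      have "c s * w s n * (1 / l ^ (r * i - s)) =
          real n ^ r * (c s * (fact s * count_weight n r (t n) s)) * (l ^ (m - 1)) ^ r / (l ^ s * l ^ (r * i - s))"
        unfolding w_def l_def[symmetric] power_mult_distrib by simp
      then show ?thesis
        unfolding e using l by simp
    qed
    then show ?case
      by (simp add: few_prob_def sum_distrib_left sum_divide_distrib flip: l_def c_def)
  qed
  ultimately show ?thesis
    by (simp add: tendsto_cong)
qed

context coupon_collection
begin

text \<open>Both sides count the \<open>r\<close>-element sets of types all of which have at most \<open>i\<close> copies.\<close>

lemma few_types_choose:
  "real (few_types n i (\<lambda>s. C s \<omega>) t choose r) =
    (\<Sum>A | A \<subseteq> {..<n} \<and> card A = r. of_bool (\<forall>j\<in>A. copies (\<lambda>s. C s \<omega>) t j \<le> i))"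
proof -
  define F where "F = {j. j < n \<and> copies (\<lambda>s. C s \<omega>) t j \<le> i}"
  have "finite F" unfolding F_def by simp
  then have "real (few_types n i (\<lambda>s. C s \<omega>) t choose r) = real (card {A. A \<subseteq> F \<and> card A = r})"
    by (simp add: few_types_def F_def n_subsets)
  also have "\<dots> = (\<Sum>A | A \<subseteq> {..<n} \<and> card A = r. of_bool (A \<subseteq> F))"
  proof -
    have "{A. A \<subseteq> F \<and> card A = r} = {A \<in> {A. A \<subseteq> {..<n} \<and> card A = r}. A \<subseteq> F}"
      by (auto simp: F_def)
    moreover have "finite {A. A \<subseteq> {..<n} \<and> card A = r}" by simp
    ultimately show ?thesis by (simp add: Int_def)
  qed
  also have "\<dots> = (\<Sum>A | A \<subseteq> {..<n} \<and> card A = r. of_bool (\<forall>j\<in>A. copies (\<lambda>s. C s \<omega>) t j \<le> i))"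
    by (intro sum.cong refl arg_cong[of _ _ of_bool]) (auto simp: F_def)
  finally show ?thesis .
qed

lemma measurable_few_types [measurable]:
  "(\<lambda>\<omega>. few_types n i (\<lambda>s. C s \<omega>) t) \<in> measurable M (count_space UNIV)"
proof -
  have "few_types n i (\<lambda>s. C s \<omega>) t = (\<Sum>j<n. of_bool (copies (\<lambda>s. C s \<omega>) t j \<le> i))" for \<omega>
    by (simp add: few_types_def Int_def lessThan_def)
  then show ?thesis by simp
qed

lemma expectation_few_types_choose:
  "expectation (\<lambda>\<omega>. real (few_types n i (\<lambda>s. C s \<omega>) t choose r)) = real (n choose r) * few_prob n i r t"
proof -
  have fin: "finite A" if "A \<subseteq> {..<n}" for A
    using that finite_subset by blast
  have "expectation (\<lambda>\<omega>. real (few_types n i (\<lambda>s. C s \<omega>) t choose r)) =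
      expectation (\<lambda>\<omega>. \<Sum>A | A \<subseteq> {..<n} \<and> card A = r.
        indicator {\<omega> \<in> space M. \<forall>j\<in>A. copies (\<lambda>s. C s \<omega>) t j \<le> i} \<omega>)"
    unfolding few_types_choose by (intro Bochner_Integration.integral_cong refl sum.cong) auto
  also have "\<dots> = (\<Sum>A | A \<subseteq> {..<n} \<and> card A = r.
      prob {\<omega> \<in> space M. \<forall>j\<in>A. copies (\<lambda>s. C s \<omega>) t j \<le> i})"
    using fin by (subst Bochner_Integration.integral_sum)
      (auto intro!: sum.cong integrable_real_indicator simp: emeasure_eq_measure)
  also have "\<dots> = (\<Sum>A | A \<subseteq> {..<n} \<and> card A = r. few_prob n i r t)"
    by (intro sum.cong refl) (auto simp: prob_copies_le few_prob_def)
  also have "\<dots> = real (n choose r) * few_prob n i r t"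
    using n_subsets[of "{..<n}" r] by simp
  finally show ?thesis .
qed

end

lemma factorial_moment_asymptotics:
  assumes lim: "(\<lambda>n. deficit m n (t n)) \<longlonglongrightarrow> y" and y: "0 < y"
    and m: "1 \<le> m" "m \<le> i + 1"
  shows "(\<lambda>n. real (n choose r) * few_prob n i r (t n) / ln (real n) ^ (r * (i + 1 - m)))
    \<longlonglongrightarrow> (y / fact i) ^ r / fact r"
proof -
  have "(\<lambda>n. fact r * real (n choose r) / real n ^ r *
      (real n ^ r * few_prob n i r (t n) / ln (real n) ^ (r * (i + 1 - m))) / fact r)
    \<longlonglongrightarrow> 1 * (y / fact i) ^ r / fact r"
    by (intro tendsto_intros binomial_asymptotics few_prob_asymptotics[OF lim y m]) simp
  moreover have "\<forall>\<^sub>F n in sequentially. fact r * real (n choose r) / real n ^ r *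
      (real n ^ r * few_prob n i r (t n) / ln (real n) ^ (r * (i + 1 - m))) / fact r =
      real (n choose r) * few_prob n i r (t n) / ln (real n) ^ (r * (i + 1 - m))"
    using eventually_gt_at_top[of 0] by eventually_elim simp
  ultimately show ?thesis
    by (simp add: tendsto_cong)
qed

section \<open>From moments to probabilities\<close>

lemma (in prob_space) integrable_choose:
  assumes [measurable]: "N \<in> measurable M (count_space UNIV)"
    and bdd: "\<And>\<omega>. \<omega> \<in> space M \<Longrightarrow> N \<omega> \<le> (B :: nat)"
  shows "integrable M (\<lambda>\<omega>. real (N \<omega> choose r))"
proof (rule integrable_const_bound)
  show "AE \<omega> in M. norm (real (N \<omega> choose r)) \<le> (\<Sum>b\<le>B. real (b choose r))"
    using bdd by (intro AE_I2) (auto intro!: member_le_sum)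
qed measurable

text \<open>For a single value \<open>k > 0\<close> the alternating partial sum of the \<open>k choose r\<close> collapses to
\<open>(-1)^R * (k - 1 choose R)\<close>, which has the sign of \<open>(-1)^R\<close>; for \<open>k = 0\<close> it equals one. The
claim is the expectation of this pointwise fact.\<close>

lemma (in prob_space) Bonferroni_inequalities:
  assumes N [measurable]: "N \<in> measurable M (count_space UNIV)"
    and bdd: "\<And>\<omega>. \<omega> \<in> space M \<Longrightarrow> N \<omega> \<le> (B :: nat)"
  shows "0 \<le> (-1) ^ R *
    ((\<Sum>r\<le>R. (-1) ^ r * expectation (\<lambda>\<omega>. real (N \<omega> choose r))) - prob {\<omega> \<in> space M. N \<omega> = 0})"
proof -
  have int: "integrable M (\<lambda>\<omega>. real (N \<omega> choose r))" for r
    by (rule integrable_choose[OF N bdd])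
  have "0 \<le> (-1) ^ R * ((\<Sum>r\<le>R. (-1) ^ r * real (k choose r)) - of_bool (k = 0))" for k
  proof (cases k)
    case 0
    have "(\<Sum>r\<le>R. (-1) ^ r * real (0 choose r)) = (\<Sum>r\<in>{0}. (-1) ^ r * real (0 choose r))"
      by (rule sum.mono_neutral_right) auto
    then show ?thesis using 0 by simp
  next
    case (Suc k')
    have "(\<Sum>r\<le>R. (-1) ^ r * real (k choose r)) = (\<Sum>r\<le>R. (real k gchoose r) * (-1) ^ r)"
      by (simp add: binomial_gbinomial mult.commute)
    also have "\<dots> = (-1) ^ R * (real k - 1 gchoose R)"
      by (rule gbinomial_sum_lower_neg)
    also have "real k - 1 gchoose R = real (k' choose R)"
      by (simp add: Suc binomial_gbinomial)
    finally show ?thesis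
      using Suc by (simp flip: power_add mult.assoc)
  qed
  then have "0 \<le> expectation (\<lambda>\<omega>. (-1) ^ R *
      ((\<Sum>r\<le>R. (-1) ^ r * real (N \<omega> choose r)) - of_bool (N \<omega> = 0)))"
    by (intro integral_nonneg_AE AE_I2)
  also have "\<dots> = (-1) ^ R * expectation (\<lambda>\<omega>.
      (\<Sum>r\<le>R. (-1) ^ r * real (N \<omega> choose r)) - indicator {\<omega> \<in> space M. N \<omega> = 0} \<omega>)"
    by (subst integral_mult_right_zero[symmetric]) (auto intro!: Bochner_Integration.integral_cong)
  also have "\<dots> = (-1) ^ R *
    ((\<Sum>r\<le>R. (-1) ^ r * expectation (\<lambda>\<omega>. real (N \<omega> choose r))) - prob {\<omega> \<in> space M. N \<omega> = 0})"
    by (subst Bochner_Integration.integral_diff)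
      (auto intro!: Bochner_Integration.integrable_sum integrable_mult_right int integrable_real_indicator
        simp: emeasure_eq_measure Bochner_Integration.integral_sum int)
  finally show ?thesis .
qed

text \<open>Factorial moments \<open>x^r / r!\<close> are those of a Poisson variable, whose probability of zero is
\<open>exp (- x)\<close>. The partial sums bound \<open>p\<close> from both sides for any fixed order \<open>R\<close>, so it is
possible to let \<open>n\<close> tend to infinity first and \<open>R\<close> afterwards.\<close>

lemma tendsto_exp_of_Bonferroni:
  fixes p :: "nat \<Rightarrow> real"
  assumes bonf: "\<And>R. \<forall>\<^sub>F n in sequentially. 0 \<le> (-1) ^ R * ((\<Sum>r\<le>R. (-1) ^ r * e n r) - p n)"
    and e: "\<And>r. (\<lambda>n. e n r) \<longlonglongrightarrow> x ^ r / fact r"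
  shows "p \<longlonglongrightarrow> exp (- x)"
proof -
  define S where "S = (\<lambda>R. \<Sum>r\<le>R. (-1) ^ r * (x ^ r / fact r))"
  have partial: "(\<lambda>n. \<Sum>r\<le>R. (-1) ^ r * e n r) \<longlonglongrightarrow> S R" for R
    unfolding S_def by (intro tendsto_intros e)
  have "(\<lambda>r. (- x) ^ r / fact r) sums exp (- x)"
    using exp_converges[of "- x"] by (simp add: divide_inverse mult.commute)
  then have S: "S \<longlonglongrightarrow> exp (- x)"
    unfolding sums_def_le S_def by (simp add: power_minus[of x])
  have even: "(\<lambda>R. S (2 * R)) \<longlonglongrightarrow> exp (- x)" and odd: "(\<lambda>R. S (2 * R + 1)) \<longlonglongrightarrow> exp (- x)"
    by (rule filterlim_compose[OF S], real_asymp)+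
  show ?thesis
  proof (rule order_tendstoI)
    fix a assume "a < exp (- x)"
    then obtain R where "a < S (2 * R + 1)"
      using order_tendstoD(1)[OF odd] by (auto simp: eventually_sequentially)
    then have "\<forall>\<^sub>F n in sequentially. a < (\<Sum>r\<le>2 * R + 1. (-1) ^ r * e n r)"
      by (rule order_tendstoD(1)[OF partial])
    with bonf[of "2 * R + 1"] show "\<forall>\<^sub>F n in sequentially. a < p n"
      by eventually_elim simp
  next
    fix a assume "exp (- x) < a"
    then obtain R where "S (2 * R) < a"
      using order_tendstoD(2)[OF even] by (auto simp: eventually_sequentially)
    then have "\<forall>\<^sub>F n in sequentially. (\<Sum>r\<le>2 * R. (-1) ^ r * e n r) < a"
      by (rule order_tendstoD(2)[OF partial])
    with bonf[of "2 * R"] show "\<forall>\<^sub>F n in sequentially. p n < a"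
      by eventually_elim simp
  qed
qed

text \<open>Markov's inequality for the square, which is expanded in binomial coefficients so that the bound is in terms of
the first two factorial moments.\<close>

lemma (in prob_space) second_moment_deviation:
  assumes N [measurable]: "N \<in> measurable M (count_space UNIV)"
    and bdd: "\<And>\<omega>. \<omega> \<in> space M \<Longrightarrow> N \<omega> \<le> (B :: nat)" and \<epsilon>: "0 < \<epsilon>"
  shows "prob {\<omega> \<in> space M. \<epsilon> \<le> \<bar>real (N \<omega>) / b - c\<bar>} \<le>
    (2 * expectation (\<lambda>\<omega>. real (N \<omega> choose 2)) / b\<^sup>2 + expectation (\<lambda>\<omega>. real (N \<omega> choose 1)) / b * (1 / b)
      - 2 * c * (expectation (\<lambda>\<omega>. real (N \<omega> choose 1)) / b) + c\<^sup>2) / \<epsilon>\<^sup>2"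
proof -
  have int: "integrable M (\<lambda>\<omega>. real (N \<omega> choose r))" for r
    by (rule integrable_choose[OF N bdd])
  have sq: "(real k / b - c)\<^sup>2 = 2 / b\<^sup>2 * real (k choose 2) + (1 / b\<^sup>2 - 2 * c / b) * real (k choose 1) + c\<^sup>2" for k
  proof -
    have "2 * real (k choose 2) = real k * real k - real k"
    proof -
      have "even (k * (k - 1))" by (cases k) auto
      then have "2 * (k choose 2) = k * (k - 1)" by (simp add: choose_two)
      then have "real (2 * (k choose 2)) = real (k * (k - 1))" by (simp only:)
      then show ?thesis by (cases k) (simp_all add: algebra_simps)
    qed
    then have "2 / b\<^sup>2 * real (k choose 2) = (real k * real k - real k) / b\<^sup>2" by simp
    then show ?thesis
      by (simp only:) (simp add: power2_eq_square algebra_simps diff_divide_distrib)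
  qed
  have "{\<omega> \<in> space M. \<epsilon> \<le> \<bar>real (N \<omega>) / b - c\<bar>} = {\<omega> \<in> space M. \<epsilon>\<^sup>2 \<le> (real (N \<omega>) / b - c)\<^sup>2}"
    using \<epsilon> abs_le_square_iff[of \<epsilon>] by auto
  moreover have "prob {\<omega> \<in> space M. \<epsilon>\<^sup>2 \<le> (real (N \<omega>) / b - c)\<^sup>2} \<le>
      expectation (\<lambda>\<omega>. (real (N \<omega>) / b - c)\<^sup>2) / \<epsilon>\<^sup>2"
  proof (rule integral_Markov_inequality_measure[where A = "space M"])
    show "integrable M (\<lambda>\<omega>. (real (N \<omega>) / b - c)\<^sup>2)"
      unfolding sq by (intro Bochner_Integration.integrable_add integrable_mult_right int integrable_const)
  qed (use \<epsilon> in auto)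
  moreover have "expectation (\<lambda>\<omega>. (real (N \<omega>) / b - c)\<^sup>2) =
      2 / b\<^sup>2 * expectation (\<lambda>\<omega>. real (N \<omega> choose 2)) +
      (1 / b\<^sup>2 - 2 * c / b) * expectation (\<lambda>\<omega>. real (N \<omega> choose 1)) + c\<^sup>2"
    unfolding sq using int[of 2] int[of 1] by (simp add: prob_space)
  moreover have "\<dots> = 2 * expectation (\<lambda>\<omega>. real (N \<omega> choose 2)) / b\<^sup>2 + expectation (\<lambda>\<omega>. real (N \<omega> choose 1)) / b * (1 / b)
      - 2 * c * (expectation (\<lambda>\<omega>. real (N \<omega> choose 1)) / b) + c\<^sup>2"
    by (simp add: power2_eq_square algebra_simps diff_divide_distrib)
  ultimately show ?thesis by (simp only:)
qed

section \<open>Limits at and near the completion time\<close>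

text \<open>One collection process for every number \<open>n\<close> of types, possibly on different probability spaces.\<close>

locale coupon_collections =
  fixes M :: "nat \<Rightarrow> 'a measure" and C :: "nat \<Rightarrow> nat \<Rightarrow> 'a \<Rightarrow> nat" and m :: nat
  assumes collection: "\<And>n. 1 \<le> n \<Longrightarrow> coupon_collection (M n) n (C n)"
    and m_pos: "1 \<le> m"
begin

abbreviation few :: "nat \<Rightarrow> nat \<Rightarrow> nat \<Rightarrow> 'a \<Rightarrow> nat" where
  "few n i t \<omega> \<equiv> few_types n i (\<lambda>s. C n s \<omega>) t"

lemma prob_none_few:
  assumes lim: "(\<lambda>n. deficit m n (t n)) \<longlonglongrightarrow> y" and y: "0 < y"
  shows "(\<lambda>n. measure (M n) {\<omega> \<in> space (M n). few n (m - 1) (t n) \<omega> = 0})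
    \<longlonglongrightarrow> exp (- (y / fact (m - 1)))"
proof (rule tendsto_exp_of_Bonferroni)
  show "(\<lambda>n. real (n choose r) * few_prob n (m - 1) r (t n)) \<longlonglongrightarrow> (y / fact (m - 1)) ^ r / fact r" for r
    using factorial_moment_asymptotics[OF lim y m_pos, of "m - 1" r] m_pos by simp
  show "\<forall>\<^sub>F n in sequentially. 0 \<le> (-1) ^ R *
      ((\<Sum>r\<le>R. (-1) ^ r * (real (n choose r) * few_prob n (m - 1) r (t n))) -
        measure (M n) {\<omega> \<in> space (M n). few n (m - 1) (t n) \<omega> = 0})" for R
    using eventually_ge_at_top[of 1]
  proof eventually_elim
    case (elim n)
    interpret coupon_collection "M n" n "C n"
      by (rule collection[OF elim])
    show ?case
      using Bonferroni_inequalities[OF measurable_few_types few_types_le, of R]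
      by (simp add: expectation_few_types_choose)
  qed
qed

text \<open>By \<open>factorial_moment_asymptotics\<close>, the second moment of \<open>few_types / (ln n)^(i - m + 1)\<close> is
asymptotically the square of its mean \<open>y / i!\<close>. The difference between the second moment and the second
factorial moment disappears because the mean of \<open>few_types\<close> tends to infinity.\<close>

lemma few_concentrates:
  assumes lim: "(\<lambda>n. deficit m n (t n)) \<longlonglongrightarrow> y" and y: "0 < y"
    and i: "m \<le> i" and \<epsilon>: "0 < \<epsilon>"
  shows "(\<lambda>n. measure (M n) {\<omega> \<in> space (M n).
      \<epsilon> \<le> \<bar>fact i * real (few n i (t n) \<omega>) / ln (real n) ^ (i - m + 1) - y\<bar>}) \<longlonglongrightarrow> 0"
proof (rule tendsto_sandwich[where f = "\<lambda>_. 0"])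
  define c \<delta> where "c = y / fact i" and "\<delta> = \<epsilon> / fact i"
  define b where "b = (\<lambda>n. ln (real n) ^ (i - m + 1))"
  define e where "e = (\<lambda>r n. real (n choose r) * few_prob n i r (t n))"
  have \<delta>: "0 < \<delta>" using \<epsilon> by (simp add: \<delta>_def)
  have mom: "(\<lambda>n. e r n / b n ^ r) \<longlonglongrightarrow> c ^ r / fact r" for r
  proof -
    have "r * (i + 1 - m) = (i - m + 1) * r"
      using i by (simp add: Suc_diff_le)
    then have "(\<lambda>n. real (n choose r) * few_prob n i r (t n) / ln (real n) ^ ((i - m + 1) * r))
        \<longlonglongrightarrow> (y / fact i) ^ r / fact r"
      using factorial_moment_asymptotics[OF lim y m_pos, of i r] i by simp
    then show ?thesis
      by (simp only: e_def b_def c_def power_mult)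
  qed
  have b: "(\<lambda>n. 1 / b n) \<longlonglongrightarrow> 0"
  proof -
    have "(\<lambda>n. (1 / ln (real n)) ^ (i - m + 1)) \<longlonglongrightarrow> 0 ^ (i - m + 1)"
      by (intro tendsto_power) real_asymp
    then show ?thesis using i by (simp add: b_def power_one_over power_0_left)
  qed
  define bound where "bound = (\<lambda>n. (2 * e 2 n / (b n)\<^sup>2 + e 1 n / b n * (1 / b n) - 2 * c * (e 1 n / b n) + c\<^sup>2) / \<delta>\<^sup>2)"
  have "(\<lambda>n. (2 * (e 2 n / (b n)\<^sup>2) + e 1 n / b n * (1 / b n) - 2 * c * (e 1 n / b n) + c\<^sup>2) / \<delta>\<^sup>2)
      \<longlonglongrightarrow> (2 * (c\<^sup>2 / 2) + c * 0 - 2 * c * c + c\<^sup>2) / \<delta>\<^sup>2"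
  proof -
    have 2: "(\<lambda>n. e 2 n / (b n)\<^sup>2) \<longlonglongrightarrow> c\<^sup>2 / 2" and 1: "(\<lambda>n. e 1 n / b n) \<longlonglongrightarrow> c"
      using mom[of 2] mom[of 1] by simp_all
    show ?thesis
      by (rule tendsto_divide[OF tendsto_add[OF tendsto_diff[OF tendsto_add[OF
            tendsto_mult[OF tendsto_const 2] tendsto_mult[OF 1 b]]
            tendsto_mult[OF tendsto_const 1]] tendsto_const] tendsto_const]) (use \<delta> in simp)
  qed
  then show "bound \<longlonglongrightarrow> 0"
    by (simp add: bound_def power2_eq_square)
  show "\<forall>\<^sub>F n in sequentially. measure (M n) {\<omega> \<in> space (M n).
      \<epsilon> \<le> \<bar>fact i * real (few n i (t n) \<omega>) / ln (real n) ^ (i - m + 1) - y\<bar>} \<le> bound n"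
    using eventually_ge_at_top[of 1]
  proof eventually_elim
    case (elim n)
    interpret coupon_collection "M n" n "C n"
      by (rule collection[OF elim])
    have "\<epsilon> \<le> \<bar>fact i * real k / b n - y\<bar> \<longleftrightarrow> \<delta> \<le> \<bar>real k / b n - c\<bar>" for k
    proof -
      have "fact i * real k / b n - y = fact i * (real k / b n - c)"
        by (simp add: c_def right_diff_distrib)
      then have "\<bar>fact i * real k / b n - y\<bar> = fact i * \<bar>real k / b n - c\<bar>"
        by (simp add: abs_mult)
      moreover have "\<epsilon> = fact i * \<delta>" by (simp add: \<delta>_def)
      ultimately show ?thesis by simp
    qed
    then show ?case
      using second_moment_deviation[OF measurable_few_types few_types_le \<delta>, of i "t n" "b n" c]
      unfolding expectation_few_types_choose by (simp only: bound_def e_def b_def)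
  qed
qed (auto simp: measure_nonneg)

definition complete :: "nat \<Rightarrow> (nat \<Rightarrow> nat) \<Rightarrow> bool" where
  "complete n c \<longleftrightarrow> (\<exists>t. few_types n (m - 1) c t = 0)"

lemma few_types_eq_0_iff: "few_types n (m - 1) c t = 0 \<longleftrightarrow> (\<forall>j<n. m \<le> copies c t j)"
proof -
  have "copies c t j \<le> m - 1 \<longleftrightarrow> \<not> m \<le> copies c t j" for j
    using m_pos by linarith
  then show ?thesis
    by (auto simp: few_types_def)
qed

lemma few_types_collection_time:
  assumes "complete n c"
  shows "few_types n (m - 1) c (collection_time n m c) = 0"
  using assms unfolding complete_def few_types_eq_0_iff collection_time_def by (rule LeastI_ex)

lemma collection_time_le_iff:
  assumes "complete n c"
  shows "collection_time n m c \<le> t \<longleftrightarrow> few_types n (m - 1) c t = 0"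
proof
  assume "collection_time n m c \<le> t"
  then show "few_types n (m - 1) c t = 0"
    using few_types_antimono[of "collection_time n m c" t n "m - 1" c] few_types_collection_time[OF assms]
    by simp
next
  assume "few_types n (m - 1) c t = 0"
  then show "collection_time n m c \<le> t"
    unfolding few_types_eq_0_iff collection_time_def by (rule Least_le)
qed

lemma measurable_collection_time:
  assumes "1 \<le> n"
  shows "(\<lambda>\<omega>. collection_time n m (\<lambda>s. C n s \<omega>)) \<in> measurable (M n) (count_space UNIV)"
proof -
  interpret coupon_collection "M n" n "C n"
    by (rule collection[OF assms])
  show ?thesis
    unfolding collection_time_def by measurable
qed

lemma measurable_complete:
  assumes "1 \<le> n"
  shows "Measurable.pred (M n) (\<lambda>\<omega>. complete n (\<lambda>s. C n s \<omega>))"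
proof -
  interpret coupon_collection "M n" n "C n"
    by (rule collection[OF assms])
  show ?thesis
    unfolding complete_def by measurable
qed

lemma measurable_num_tons:
  assumes "1 \<le> n"
  shows "(\<lambda>\<omega>. num_tons n m i (\<lambda>s. C n s \<omega>)) \<in> measurable (M n) (count_space UNIV)"
proof -
  interpret coupon_collection "M n" n "C n"
    by (rule collection[OF assms])
  note measurable_collection_time[OF assms, measurable]
  have "num_tons n m i (\<lambda>s. C n s \<omega>) =
      (\<Sum>j<n. of_bool (copies (\<lambda>s. C n s \<omega>) (collection_time n m (\<lambda>s. C n s \<omega>)) j = i))" for \<omega>
    by (simp add: num_tons_def Int_def lessThan_def)
  then show ?thesis
    by simp
qed

text \<open>An incomplete collection is in particular incomplete at any deterministic time. By \<open>prob_none_few\<close> the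
latter has limiting probability \<open>1 - exp (- y / (m - 1)!)\<close>, which is as small as desired for small
\<open>y\<close>.\<close>

lemma prob_incomplete:
  "(\<lambda>n. measure (M n) {\<omega> \<in> space (M n). \<not> complete n (\<lambda>s. C n s \<omega>)}) \<longlonglongrightarrow> 0"
proof (rule order_tendstoI)
  fix a :: real assume a: "0 < a"
  have "((\<lambda>y. 1 - exp (- (y / fact (m - 1)))) \<longlongrightarrow> 1 - exp (- (0 / fact (m - 1)))) (at_right (0::real))"
    by (intro tendsto_intros)  simp
  then have "\<forall>\<^sub>F y in at_right (0::real). 1 - exp (- (y / fact (m - 1))) < a"
    using a by (intro order_tendstoD(2)) simp_all
  then obtain y where y: "0 < y" "1 - exp (- (y / fact (m - 1))) < a"
    unfolding eventually_at_right_field using dense by blast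
  obtain t where lim: "(\<lambda>n. deficit m n (t n)) \<longlonglongrightarrow> y"
    using exists_threshold_time[OF y(1)] by blast
  have "(\<lambda>n. 1 - measure (M n) {\<omega> \<in> space (M n). few n (m - 1) (t n) \<omega> = 0})
      \<longlonglongrightarrow> 1 - exp (- (y / fact (m - 1)))"
    by (intro tendsto_intros prob_none_few[OF lim y(1)])
  from order_tendstoD(2)[OF this y(2)] eventually_ge_at_top[of 1]
  show "\<forall>\<^sub>F n in sequentially. measure (M n) {\<omega> \<in> space (M n). \<not> complete n (\<lambda>s. C n s \<omega>)} < a"
  proof eventually_elim
    case (elim n)
    interpret coupon_collection "M n" n "C n"
      by (rule collection[OF elim(2)])
    note measurable_complete[OF elim(2), measurable]
    have "prob {\<omega> \<in> space (M n). \<not> complete n (\<lambda>s. C n s \<omega>)} \<le>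
        prob {\<omega> \<in> space (M n). \<not> few n (m - 1) (t n) \<omega> = 0}"
      by (rule finite_measure_mono) (auto simp: complete_def)
    also have "\<dots> = 1 - prob {\<omega> \<in> space (M n). few n (m - 1) (t n) \<omega> = 0}"
      by (rule prob_neg) measurable
    finally show ?case using elim(1) by simp
  qed
next
  fix a :: real assume "a < 0"
  then have "a < measure (M n) A" for n A
    by (rule less_le_trans[OF _ measure_nonneg])
  then show "\<forall>\<^sub>F n in sequentially. a < measure (M n) {\<omega> \<in> space (M n). \<not> complete n (\<lambda>s. C n s \<omega>)}"
    by (intro always_eventually allI)
qed

text \<open>\<open>deficit m n T \<le> y\<close> means that \<open>T\<close> comes after a threshold time, hence that at the threshold time
some type still has fewer than \<open>m\<close> copies. This equivalence fails only on outcomes where the collection is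
never completed.\<close>

lemma deficit_at_collection_time_cdf:
  assumes y: "0 < y"
  shows "(\<lambda>n. measure (M n) {\<omega> \<in> space (M n). deficit m n (collection_time n m (\<lambda>s. C n s \<omega>)) \<le> y})
    \<longlonglongrightarrow> 1 - exp (- (y / fact (m - 1)))"
proof -
  obtain t where lim: "(\<lambda>n. deficit m n (t n)) \<longlonglongrightarrow> y"
    and t: "\<forall>\<^sub>F n in sequentially. \<forall>T. deficit m n T \<le> y \<longleftrightarrow> t n < T"
    using exists_threshold_time[OF y] by blast
  define late where "late = (\<lambda>n. measure (M n) {\<omega> \<in> space (M n). deficit m n (collection_time n m (\<lambda>s. C n s \<omega>)) \<le> y})"
  define some_few where "some_few = (\<lambda>n. 1 - measure (M n) {\<omega> \<in> space (M n). few n (m - 1) (t n) \<omega> = 0})"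
  define inc where "inc = (\<lambda>n. measure (M n) {\<omega> \<in> space (M n). \<not> complete n (\<lambda>s. C n s \<omega>)})"
  have some_few: "some_few \<longlonglongrightarrow> 1 - exp (- (y / fact (m - 1)))"
    unfolding some_few_def by (intro tendsto_intros prob_none_few[OF lim y])
  have inc: "inc \<longlonglongrightarrow> 0"
    unfolding inc_def by (rule prob_incomplete)
  have ev: "\<forall>\<^sub>F n in sequentially. some_few n - inc n \<le> late n \<and> late n \<le> some_few n + inc n"
    using eventually_ge_at_top[of 1] t
  proof eventually_elim
    case (elim n)
    interpret coupon_collection "M n" n "C n"
      by (rule collection[OF elim(1)])
    note measurable_complete[OF elim(1), measurable] measurable_collection_time[OF elim(1), measurable]
    define L where "L = {\<omega> \<in> space (M n). t n < collection_time n m (\<lambda>s. C n s \<omega>)}"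
    define F where "F = {\<omega> \<in> space (M n). \<not> few n (m - 1) (t n) \<omega> = 0}"
    define I where "I = {\<omega> \<in> space (M n). \<not> complete n (\<lambda>s. C n s \<omega>)}"
    have sets [measurable]: "L \<in> events" "F \<in> events" "I \<in> events"
      unfolding L_def F_def I_def by measurable
    have *: "\<omega> \<in> L \<longleftrightarrow> \<omega> \<in> F" if "\<omega> \<in> space (M n)" "\<omega> \<notin> I" for \<omega>
      using that collection_time_le_iff[of n "\<lambda>s. C n s \<omega>" "t n"] by (auto simp: L_def F_def I_def)
    have "late n = prob L" "inc n = prob I"
      using elim by (simp_all add: late_def inc_def L_def I_def)
    moreover have "some_few n = prob F"
      unfolding some_few_def F_def by (rule prob_neg[symmetric]) measurable
    moreover have "prob L \<le> prob (F \<union> I)" "prob F \<le> prob (L \<union> I)"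
      using * sets.sets_into_space[OF sets(1)] sets.sets_into_space[OF sets(2)]
      by (auto intro!: finite_measure_mono)
    moreover have "prob (F \<union> I) \<le> prob F + prob I" "prob (L \<union> I) \<le> prob L + prob I"
      by (auto intro!: measure_Un_le)
    ultimately show ?case by linarith
  qed
  have "late \<longlonglongrightarrow> 1 - exp (- (y / fact (m - 1)))"
  proof (rule tendsto_sandwich)
    show "\<forall>\<^sub>F n in sequentially. some_few n - inc n \<le> late n"
      and "\<forall>\<^sub>F n in sequentially. late n \<le> some_few n + inc n"
      using ev by (auto elim: eventually_mono)
  qed (use tendsto_diff[OF some_few inc] tendsto_add[OF some_few inc] in auto)
  then show ?thesis by (simp add: late_def)
qed

abbreviation scaled_tons :: "nat \<Rightarrow> nat \<Rightarrow> (nat \<Rightarrow> nat) \<Rightarrow> real" where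
  "scaled_tons n i c \<equiv> fact i * real (num_tons n m i c) / ln (real n) ^ (i - m + 1)"

abbreviation scaled_few :: "nat \<Rightarrow> nat \<Rightarrow> (nat \<Rightarrow> nat) \<Rightarrow> nat \<Rightarrow> real" where
  "scaled_few n i c t \<equiv> fact i * real (few_types n i c t) / ln (real n) ^ (i - m + 1)"

lemma scaled_tons_le:
  assumes i: "m \<le> i" and n: "3 \<le> n"
  shows "scaled_tons n i c \<le> scaled_few n i c (collection_time n m c)"
proof -
  have "1 \<le> i" using i m_pos by simp
  then have "num_tons n m i c \<le> few_types n i c (collection_time n m c)"
    using few_types_split[of i n c "collection_time n m c"] by (simp add: num_tons_def)
  then show ?thesis
    using n by (intro divide_right_mono mult_left_mono) auto
qed

text \<open>The types with fewer than \<open>i\<close> copies are negligible: on the scale for \<open>i - 1\<close> they are bounded by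
\<open>B\<close>, and the scale for \<open>i\<close> is larger by a factor \<open>ln n\<close>. For \<open>i = m\<close> there are none at the
completion time.\<close>

lemma scaled_tons_ge:
  assumes i: "m \<le> i" and n: "3 \<le> n" and c: "complete n c"
    and bound: "\<And>j. m \<le> j \<Longrightarrow> j \<le> i \<Longrightarrow> scaled_few n j c (collection_time n m c) \<le> B" and B: "0 \<le> B"
  shows "scaled_few n i c (collection_time n m c) - real i * B / ln (real n) \<le> scaled_tons n i c"
proof -
  define T where "T = collection_time n m c"
  define l where "l = ln (real n)"
  have l: "0 < l" using n by (simp add: l_def)
  have i1: "1 \<le> i" using i m_pos by simp
  have "scaled_few n i c T = scaled_tons n i c + fact i * real (few_types n (i - 1) c T) / l ^ (i - m + 1)"
    using few_types_split[OF i1, of n c T]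
    by (simp add: num_tons_def T_def l_def add_divide_distrib distrib_left)
  moreover have "fact i * real (few_types n (i - 1) c T) / l ^ (i - m + 1) \<le> real i * B / l"
  proof (cases "i = m")
    case True
    then show ?thesis
      using few_types_collection_time[OF c] B l by (simp add: T_def)
  next
    case False
    then have im: "m \<le> i - 1" using i by auto
    then have "scaled_few n (i - 1) c T \<le> B"
      unfolding T_def by (rule bound) simp
    then have "real i / l * scaled_few n (i - 1) c T \<le> real i / l * B"
      using l by (intro mult_left_mono) auto
    moreover have "fact i = real i * fact (i - 1)"
      using i1 by (simp add: fact_reduce)
    moreover have "i - m + 1 = Suc (i - 1 - m + 1)" using im i1 by linarith
    ultimately show ?thesis
      by (simp add: mult_ac flip: l_def)
  qed
  ultimately show ?thesis by (simp add: T_def l_def)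
qed

text \<open>The deterministic core of the argument. The numbers \<open>\<epsilon> * l\<close> for \<open>l \<in> {1..L}\<close> form a grid of values of
\<open>deficit\<close>, with \<open>t l\<close> the corresponding threshold times. If the value at the completion time falls
between two neighbouring grid points, monotonicity squeezes the scaled counts at the completion time between
those at the two threshold times, which are within \<open>\<epsilon>\<close> of the grid points.\<close>

lemma scaled_tons_close:
  fixes L :: nat and t :: "nat \<Rightarrow> nat"
  assumes n: "3 \<le> n" and c: "complete n c" and \<epsilon>: "0 < \<epsilon>"
    and t: "\<And>l T. l \<in> {1..L} \<Longrightarrow> deficit m n T \<le> \<epsilon> * real l \<longleftrightarrow> t l < T"
    and conc: "\<And>l i. l \<in> {1..L} \<Longrightarrow> i \<in> {m..k} \<Longrightarrow> \<bar>scaled_few n i c (t l) - \<epsilon> * real l\<bar> < \<epsilon>"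
    and L: "deficit m n (collection_time n m c) \<le> \<epsilon> * real L"
    and large: "real k * (\<epsilon> * (real L + 2)) / ln (real n) \<le> \<epsilon>"
    and i: "i \<in> {m..k}"
  shows "\<bar>scaled_tons n i c - deficit m n (collection_time n m c)\<bar> \<le> 3 * \<epsilon>"
proof -
  define T where "T = collection_time n m c"
  define W where "W = deficit m n T"
\<comment> \<open>The deficit \<open>W\<close> at completion lies in the grid cell from \<open>\<epsilon> * (l - 1)\<close> to \<open>\<epsilon> * l\<close>.\<close>
    define l where "l = (LEAST l. W \<le> \<epsilon> * real l)"
  have ln: "0 < ln (real n)" using n by simp
  have W: "0 < W"
    unfolding W_def by (rule deficit_pos[OF n])
  have l: "W \<le> \<epsilon> * real l" "l \<le> L"
    using L unfolding l_def W_def T_def by (auto intro: LeastI Least_le)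
  have l0: "0 < l"
    using l(1) W by (cases l) auto
  have W_ge: "\<epsilon> * real (l - 1) < W"
    using not_less_Least[of "l - 1" "\<lambda>l. W \<le> \<epsilon> * real l"] l0 by (simp add: l_def)
  have l1: "\<epsilon> * real (l - 1) = \<epsilon> * real l - \<epsilon>"
    using l0 by (simp add: of_nat_diff algebra_simps)
  have mono: "scaled_few n j c s' \<le> scaled_few n j c s" if "s \<le> s'" for j s s'
    using ln few_types_antimono[OF that, of n j c] by (intro divide_right_mono mult_left_mono) auto
  have up: "scaled_few n j c T \<le> \<epsilon> * real l + \<epsilon>" if j: "j \<in> {m..k}" for j
  proof -
    have "t l < T"
      using t[of l T] l l0 by (simp add: W_def)
    then have "scaled_few n j c T \<le> scaled_few n j c (t l)"
      by (intro mono) simp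
    then show ?thesis
      using conc[of l j] j l l0 by (simp add: abs_less_iff)
  qed
  have down: "\<epsilon> * real (l - 1) - \<epsilon> \<le> scaled_few n i c T"
\<comment> \<open>In the first cell there is no lower threshold time, but nonnegativity is enough.\<close>
    proof (cases "l = 1")
    case True
    have "0 \<le> scaled_few n i c T" using ln by simp
    then show ?thesis using True \<epsilon> by simp
  next
    case False
    then have l': "l - 1 \<in> {1..L}" using l l0 by auto
    have "T \<le> t (l - 1)"
      using t[OF l', of T] W_ge by (simp add: W_def)
    then have "scaled_few n i c (t (l - 1)) \<le> scaled_few n i c T"
      by (rule mono)
    then show ?thesis
      using conc[OF l' i] by (simp add: abs_less_iff)
  qed
  define B where "B = \<epsilon> * (real L + 2)"
  have "scaled_few n i c T - real i * B / ln (real n) \<le> scaled_tons n i c"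
    unfolding T_def
  proof (rule scaled_tons_ge[OF _ n c])
    fix j assume "m \<le> j" "j \<le> i"
    then have "scaled_few n j c T \<le> \<epsilon> * real l + \<epsilon>" using i by (intro up) auto
    also have "\<dots> \<le> B"
    proof -
      have "\<epsilon> * real l \<le> \<epsilon> * real L" using \<epsilon> l(2) by simp
      then show ?thesis using \<epsilon> unfolding B_def distrib_left by linarith
    qed
    finally show "scaled_few n j c (collection_time n m c) \<le> B" by (simp add: T_def)
  qed (use i \<epsilon> in \<open>auto simp: B_def\<close>)
  moreover have "real i * B / ln (real n) \<le> \<epsilon>"
  proof -
    have "real i * B / ln (real n) \<le> real k * B / ln (real n)"
      using ln i \<epsilon> by (intro divide_right_mono mult_right_mono) (auto simp: B_def)
    then show ?thesis using large by (simp add: B_def)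
  qed
  moreover have "scaled_tons n i c \<le> scaled_few n i c T"
    unfolding T_def using i n by (intro scaled_tons_le) auto
  moreover have "scaled_few n i c T \<le> \<epsilon> * real l + \<epsilon>" by (rule up[OF i])
  ultimately show ?thesis
    using down W_ge l(1) l1 unfolding T_def[symmetric] W_def[symmetric] abs_le_iff by linarith
qed

lemma scaled_tons_close_in_probability:
  assumes \<delta>: "0 < \<delta>"
  shows "(\<lambda>n. measure (M n) {\<omega> \<in> space (M n). \<exists>i\<in>{m..k}.
      \<delta> < \<bar>scaled_tons n i (\<lambda>s. C n s \<omega>) - deficit m n (collection_time n m (\<lambda>s. C n s \<omega>))\<bar>}) \<longlonglongrightarrow> 0"
proof (rule order_tendstoI)
  fix a :: real assume a: "0 < a"
  define \<epsilon> where "\<epsilon> = \<delta> / 3"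
  have \<epsilon>: "0 < \<epsilon>" using \<delta> by (simp add: \<epsilon>_def)
\<comment> \<open>The grid reaches far enough that the exponential law gives mass less than \<open>a\<close> beyond it.\<close>
    obtain L :: nat where L: "0 < L" "exp (- (\<epsilon> * real L / fact (m - 1))) < a"
  proof -
    have "(\<lambda>L. exp (- (\<epsilon> / fact (m - 1) * real L))) \<longlonglongrightarrow> 0"
      using \<epsilon> by real_asymp
    from order_tendstoD(2)[OF this a] eventually_gt_at_top[of 0]
    have "\<forall>\<^sub>F L in sequentially. 0 < L \<and> exp (- (\<epsilon> * real L / fact (m - 1))) < a"
      by eventually_elim simp
    then show ?thesis
      using that by (auto simp: eventually_sequentially)
  qed
  have "\<forall>l\<in>{1..L}. \<exists>t. (\<lambda>n. deficit m n (t n)) \<longlonglongrightarrow> \<epsilon> * real l \<and>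
      (\<forall>\<^sub>F n in sequentially. \<forall>T. deficit m n T \<le> \<epsilon> * real l \<longleftrightarrow> t n < T)"
  proof
    fix l assume "l \<in> {1..L}"
    then have "0 < \<epsilon> * real l" using \<epsilon> by simp
    then show "\<exists>t. (\<lambda>n. deficit m n (t n)) \<longlonglongrightarrow> \<epsilon> * real l \<and>
        (\<forall>\<^sub>F n in sequentially. \<forall>T. deficit m n T \<le> \<epsilon> * real l \<longleftrightarrow> t n < T)"
      by (rule exists_threshold_time[where m = m]) blast
  qed
  from bchoice[OF this] obtain t
    where t_lim: "\<And>l. l \<in> {1..L} \<Longrightarrow> (\<lambda>n. deficit m n (t l n)) \<longlonglongrightarrow> \<epsilon> * real l"
    and t_iff: "\<And>l. l \<in> {1..L} \<Longrightarrow>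
      \<forall>\<^sub>F n in sequentially. \<forall>T. deficit m n T \<le> \<epsilon> * real l \<longleftrightarrow> t l n < T"
    by blast
  define off where "off = (\<lambda>l i n. {\<omega> \<in> space (M n). \<epsilon> \<le> \<bar>scaled_few n i (\<lambda>s. C n s \<omega>) (t l n) - \<epsilon> * real l\<bar>})"
  define early where "early = (\<lambda>n. {\<omega> \<in> space (M n).
    \<not> deficit m n (collection_time n m (\<lambda>s. C n s \<omega>)) \<le> \<epsilon> * real L})"
  define inc where "inc = (\<lambda>n. {\<omega> \<in> space (M n). \<not> complete n (\<lambda>s. C n s \<omega>)})"
  define bad where "bad = (\<lambda>n. {\<omega> \<in> space (M n). \<exists>i\<in>{m..k}.
      \<delta> < \<bar>scaled_tons n i (\<lambda>s. C n s \<omega>) - deficit m n (collection_time n m (\<lambda>s. C n s \<omega>))\<bar>})"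
  have "(\<lambda>n. (\<Sum>l\<in>{1..L}. \<Sum>i\<in>{m..k}. measure (M n) (off l i n)) +
      (1 - measure (M n) {\<omega> \<in> space (M n). deficit m n (collection_time n m (\<lambda>s. C n s \<omega>)) \<le> \<epsilon> * real L}) +
      measure (M n) (inc n))
    \<longlonglongrightarrow> (\<Sum>l\<in>{1..L}. \<Sum>i\<in>{m..k}. 0) + (1 - (1 - exp (- (\<epsilon> * real L / fact (m - 1))))) + 0"
  proof (intro tendsto_add tendsto_sum tendsto_diff tendsto_const)
    show "(\<lambda>n. measure (M n) (off l i n)) \<longlonglongrightarrow> 0" if "l \<in> {1..L}" "i \<in> {m..k}" for l i
      unfolding off_def using that \<epsilon> by (intro few_concentrates t_lim) auto
    show "(\<lambda>n. measure (M n) {\<omega> \<in> space (M n).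
        deficit m n (collection_time n m (\<lambda>s. C n s \<omega>)) \<le> \<epsilon> * real L})
        \<longlonglongrightarrow> 1 - exp (- (\<epsilon> * real L / fact (m - 1)))"
      using \<epsilon> L by (intro deficit_at_collection_time_cdf) auto
    show "(\<lambda>n. measure (M n) (inc n)) \<longlonglongrightarrow> 0"
      unfolding inc_def by (rule prob_incomplete)
  qed
  then have small: "\<forall>\<^sub>F n in sequentially. (\<Sum>l\<in>{1..L}. \<Sum>i\<in>{m..k}. measure (M n) (off l i n)) +
      (1 - measure (M n) {\<omega> \<in> space (M n). deficit m n (collection_time n m (\<lambda>s. C n s \<omega>)) \<le> \<epsilon> * real L}) +
      measure (M n) (inc n) < a"
    by (rule order_tendstoD(2)) (use L in simp)
  have "(\<lambda>n. real k * (\<epsilon> * (real L + 2)) * (1 / ln (real n))) \<longlonglongrightarrow> real k * (\<epsilon> * (real L + 2)) * 0"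
    by (intro tendsto_intros) real_asymp
  then have large: "\<forall>\<^sub>F n in sequentially. real k * (\<epsilon> * (real L + 2)) * (1 / ln (real n)) < \<epsilon>"
    by (rule order_tendstoD(2)) (use \<epsilon> in simp)
  have t_iff': "\<forall>\<^sub>F n in sequentially. \<forall>l\<in>{1..L}. \<forall>T. deficit m n T \<le> \<epsilon> * real l \<longleftrightarrow> t l n < T"
    using t_iff by (intro eventually_ball_finite) auto
  have "\<forall>\<^sub>F n in sequentially. measure (M n) (bad n) < a"
    using eventually_ge_at_top[of 3] small large t_iff'
  proof eventually_elim
    case (elim n)
    then have n: "1 \<le> n" by simp
    interpret coupon_collection "M n" n "C n"
      by (rule collection[OF n])
    note measurable_complete[OF n, measurable] measurable_collection_time[OF n, measurable]
    have off_sets: "off l i n \<in> events" for l i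
      unfolding off_def by measurable
    have early_sets: "early n \<in> events" and inc_sets: "inc n \<in> events"
      unfolding early_def inc_def by measurable
\<comment> \<open>Off these finitely many exceptional events the deterministic estimate applies.\<close>
        have "bad n \<subseteq> (\<Union>l\<in>{1..L}. \<Union>i\<in>{m..k}. off l i n) \<union> early n \<union> inc n"
    proof (rule ccontr)
      assume "\<not> ?thesis"
      then obtain \<omega> where \<omega>_bad: "\<omega> \<in> bad n"
        and good: "\<omega> \<notin> (\<Union>l\<in>{1..L}. \<Union>i\<in>{m..k}. off l i n)" "\<omega> \<notin> early n" "\<omega> \<notin> inc n"
        by blast
      have \<omega>: "\<omega> \<in> space (M n)"
        using \<omega>_bad by (simp add: bad_def)
      have "\<bar>scaled_tons n i (\<lambda>s. C n s \<omega>) - deficit m n (collection_time n m (\<lambda>s. C n s \<omega>))\<bar> \<le> 3 * \<epsilon>"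
        if i: "i \<in> {m..k}" for i
      proof (rule scaled_tons_close[OF elim(1) _ \<epsilon> _ _ _ _ i])
        show "complete n (\<lambda>s. C n s \<omega>)"
          using good(3) \<omega> by (simp add: inc_def)
        show "deficit m n T \<le> \<epsilon> * real l \<longleftrightarrow> t l n < T" if "l \<in> {1..L}" for l T
          using elim(4) that by blast
        show "\<bar>scaled_few n i (\<lambda>s. C n s \<omega>) (t l n) - \<epsilon> * real l\<bar> < \<epsilon>"
          if "l \<in> {1..L}" "i \<in> {m..k}" for l i
        proof -
          have "\<omega> \<notin> off l i n" using good(1) that by blast
          then show ?thesis using \<omega> by (simp add: off_def)
        qed
        show "deficit m n (collection_time n m (\<lambda>s. C n s \<omega>)) \<le> \<epsilon> * real L"
          using good(2) \<omega> by (simp add: early_def)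
        show "real k * (\<epsilon> * (real L + 2)) / ln (real n) \<le> \<epsilon>"
          using elim(3) by simp
      qed
      then have "\<not> \<delta> < \<bar>scaled_tons n i (\<lambda>s. C n s \<omega>) - deficit m n (collection_time n m (\<lambda>s. C n s \<omega>))\<bar>"
        if "i \<in> {m..k}" for i
        using that by (simp only: \<epsilon>_def not_less) simp
      then show False
        using \<omega>_bad unfolding bad_def by blast
    qed
    then have "prob (bad n) \<le> prob ((\<Union>l\<in>{1..L}. \<Union>i\<in>{m..k}. off l i n) \<union> early n \<union> inc n)"
      using off_sets early_sets inc_sets by (intro finite_measure_mono) auto
    also have "\<dots> \<le> prob ((\<Union>l\<in>{1..L}. \<Union>i\<in>{m..k}. off l i n) \<union> early n) + prob (inc n)"
      using off_sets early_sets inc_sets by (intro measure_Un_le) auto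
    also have "prob ((\<Union>l\<in>{1..L}. \<Union>i\<in>{m..k}. off l i n) \<union> early n) \<le>
        prob (\<Union>l\<in>{1..L}. \<Union>i\<in>{m..k}. off l i n) + prob (early n)"
      using off_sets early_sets inc_sets by (intro measure_Un_le) auto
    also have "prob (\<Union>l\<in>{1..L}. \<Union>i\<in>{m..k}. off l i n) \<le> (\<Sum>l\<in>{1..L}. prob (\<Union>i\<in>{m..k}. off l i n))"
      using off_sets by (intro measure_UNION_le) auto
    also have "\<dots> \<le> (\<Sum>l\<in>{1..L}. \<Sum>i\<in>{m..k}. prob (off l i n))"
      using off_sets by (intro sum_mono measure_UNION_le) auto
    also have "prob (early n) =
        1 - prob {\<omega> \<in> space (M n). deficit m n (collection_time n m (\<lambda>s. C n s \<omega>)) \<le> \<epsilon> * real L}"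
      unfolding early_def by (rule prob_neg) measurable
    finally show ?case
      using elim(2) by linarith
  qed
  then show "\<forall>\<^sub>F n in sequentially. measure (M n) {\<omega> \<in> space (M n). \<exists>i\<in>{m..k}.
      \<delta> < \<bar>scaled_tons n i (\<lambda>s. C n s \<omega>) - deficit m n (collection_time n m (\<lambda>s. C n s \<omega>))\<bar>} < a"
    by (simp only: bad_def)
next
  fix a :: real assume "a < 0"
  then have "a < measure (M n) A" for n A
    by (rule less_le_trans[OF _ measure_nonneg])
  then show "\<forall>\<^sub>F n in sequentially. a < measure (M n) {\<omega> \<in> space (M n). \<exists>i\<in>{m..k}.
      \<delta> < \<bar>scaled_tons n i (\<lambda>s. C n s \<omega>) - deficit m n (collection_time n m (\<lambda>s. C n s \<omega>))\<bar>}"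
    by (intro always_eventually allI)
qed

end

section \<open>Convergence in distribution to a diagonal vector\<close>

text \<open>A compactness argument: along a sequence of violations, the points on the compact part of the diagonal have a
convergent subsequence, the accompanying vectors converge to the same limit, and continuity at the limit gives a
contradiction.\<close>

lemma continuous_map_uniform_near_diagonal:
  fixes f :: "('i \<Rightarrow> real) \<Rightarrow> real"
  assumes f: "continuous_map (product_topology (\<lambda>_. euclideanreal) I) euclideanreal f"
    and \<epsilon>: "0 < \<epsilon>"
  obtains \<delta> where "0 < \<delta>"
    and "\<And>v w. v \<in> extensional I \<Longrightarrow> \<bar>w\<bar> \<le> K \<Longrightarrow> (\<And>i. i \<in> I \<Longrightarrow> \<bar>v i - w\<bar> \<le> \<delta>) \<Longrightarrow>
      \<bar>f v - f (\<lambda>i\<in>I. w)\<bar> < \<epsilon>"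
proof (rule ccontr)
  assume no: "\<not> thesis"
  have "\<exists>v w. v \<in> extensional I \<and> \<bar>w\<bar> \<le> K \<and> (\<forall>i\<in>I. \<bar>v i - w\<bar> \<le> 1 / real (Suc n)) \<and>
      \<epsilon> \<le> \<bar>f v - f (\<lambda>i\<in>I. w)\<bar>" for n
  proof (rule ccontr)
    assume neg: "\<not> ?thesis"
    show False
      by (rule no[THEN notE], rule that[of "1 / real (Suc n)"]) (use neg in \<open>force simp: not_le\<close>)+
  qed
  then obtain v w where v: "\<And>n. v n \<in> extensional I" and w: "\<And>n. \<bar>w n\<bar> \<le> K"
    and vw: "\<And>n i. i \<in> I \<Longrightarrow> \<bar>v n i - w n\<bar> \<le> 1 / real (Suc n)"
    and far: "\<And>n. \<epsilon> \<le> \<bar>f (v n) - f (\<lambda>i\<in>I. w n)\<bar>"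
    by metis
  have "compact {- K..K}" by simp
  moreover have "\<forall>n. w n \<in> {- K..K}" using w by (auto simp: abs_le_iff minus_le_iff)
  ultimately obtain l r where r: "strict_mono r" and l: "(w \<circ> r) \<longlonglongrightarrow> l"
    unfolding compact_def by blast
  have w_lim: "(\<lambda>n. w (r n)) \<longlonglongrightarrow> l" using l by (simp add: o_def)
  have v_lim: "(\<lambda>n. v (r n) i) \<longlonglongrightarrow> l" if i: "i \<in> I" for i
  proof -
    have "(\<lambda>n. v n i - w n) \<longlonglongrightarrow> 0"
    proof (rule tendsto_rabs_zero_cancel, rule tendsto_sandwich[where f = "\<lambda>_. 0"])
      show "(\<lambda>n. 1 / real (Suc n)) \<longlonglongrightarrow> 0" by real_asymp
    qed (use vw[OF i] in auto)
    from LIMSEQ_subseq_LIMSEQ[OF this r] have "(\<lambda>n. v (r n) i - w (r n)) \<longlonglongrightarrow> 0"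
      by (simp add: o_def)
    from tendsto_add[OF this w_lim] show ?thesis by simp
  qed
  have "limitin (product_topology (\<lambda>_. euclideanreal) I) (\<lambda>n. v (r n)) (\<lambda>i\<in>I. l) sequentially"
    using v v_lim by (auto simp: limitin_componentwise PiE_def)
  from continuous_map_limit[OF f this]
  have fv: "(\<lambda>n. f (v (r n))) \<longlonglongrightarrow> f (\<lambda>i\<in>I. l)"
    by (simp add: o_def)
  have "limitin (product_topology (\<lambda>_. euclideanreal) I) (\<lambda>n. \<lambda>i\<in>I. w (r n)) (\<lambda>i\<in>I. l) sequentially"
    using w_lim by (auto simp: limitin_componentwise)
  from continuous_map_limit[OF f this]
  have fw: "(\<lambda>n. f (\<lambda>i\<in>I. w (r n))) \<longlonglongrightarrow> f (\<lambda>i\<in>I. l)"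
    by (simp add: o_def)
  have "(\<lambda>n. \<bar>f (v (r n)) - f (\<lambda>i\<in>I. w (r n))\<bar>) \<longlonglongrightarrow> \<bar>f (\<lambda>i\<in>I. l) - f (\<lambda>i\<in>I. l)\<bar>"
    by (intro tendsto_intros fv fw)
  then have "\<forall>\<^sub>F n in sequentially. \<bar>f (v (r n)) - f (\<lambda>i\<in>I. w (r n))\<bar> < \<epsilon>"
    by (rule order_tendstoD(2)) (use \<epsilon> in simp)
  then obtain n where "\<bar>f (v (r n)) - f (\<lambda>i\<in>I. w (r n))\<bar> < \<epsilon>"
    by (auto simp: eventually_sequentially)
  with far[of "r n"] show False by simp
qed

text \<open>Continuous test functions need not be measured by a given \<open>\<sigma>\<close>-algebra, but on a function that is not
measurable all integrals agree, because they take the default value zero.\<close>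

lemma integral_distr_not_measurable:
  "f \<notin> borel_measurable P \<Longrightarrow> (\<integral>v. f v \<partial>distr L P V) = (0 :: real)"
  by (rule not_integrable_integral_eq) (auto dest!: borel_measurable_integrable)

lemma cdf_distr:
  "V \<in> borel_measurable L \<Longrightarrow> cdf (distr L borel V) x = measure L {\<omega> \<in> space L. V \<omega> \<le> x}"
  unfolding cdf_def by (subst measure_distr) (auto intro!: arg_cong[of _ _ "measure L"])

lemma integral_tendsto_of_cdf:
  fixes M :: "nat \<Rightarrow> 'a measure" and N :: "'b measure"
    and W :: "nat \<Rightarrow> 'a \<Rightarrow> real" and X :: "'b \<Rightarrow> real" and g :: "real \<Rightarrow> real"
  assumes M: "\<And>n. prob_space (M n)" and N: "prob_space N"
    and W: "\<And>n. W n \<in> borel_measurable (M n)" and X: "X \<in> borel_measurable N"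
    and cdf: "\<And>x. (\<lambda>n. measure (M n) {\<omega> \<in> space (M n). W n \<omega> \<le> x}) \<longlonglongrightarrow> measure N {\<omega> \<in> space N. X \<omega> \<le> x}"
    and g: "continuous_on UNIV g" and bdd: "\<And>x. \<bar>g x\<bar> \<le> (B :: real)"
  shows "(\<lambda>n. \<integral>\<omega>. g (W n \<omega>) \<partial>M n) \<longlonglongrightarrow> (\<integral>\<omega>. g (X \<omega>) \<partial>N)"
proof -
  have [measurable]: "g \<in> borel_measurable borel"
    by (rule borel_measurable_continuous_onI[OF g])
  have "(\<lambda>n. integral\<^sup>L (distr (M n) borel (W n)) g) \<longlonglongrightarrow> integral\<^sup>L (distr N borel X) g"
  proof (rule weak_conv_imp_integral_bdd_continuous_conv)
    show "real_distribution (distr (M n) borel (W n))" for n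
      by (rule prob_space.real_distribution_distr[OF M W])
    show "real_distribution (distr N borel X)"
      by (rule prob_space.real_distribution_distr[OF N X])
    show "weak_conv_m (\<lambda>n. distr (M n) borel (W n)) (distr N borel X)"
      using cdf by (simp add: weak_conv_m_def weak_conv_def cdf_distr W X)
    show "isCont g x" for x
      using g by (simp add: continuous_on_eq_continuous_at)
    show "norm (g x) \<le> B" for x using bdd by simp
  qed
  then show ?thesis
    using W X by (simp add: integral_distr)
qed

text \<open>A version of Slutsky's theorem. The limits of the distribution functions at \<open>K\<close> and \<open>- K\<close> make
\<open>W n\<close> tight, and on \<open>\<bar>W n\<bar> \<le> K\<close> a continuous test function hardly distinguishes \<open>Y n\<close> from the
constant vector \<open>W n\<close>; on the diagonal the claim is convergence in distribution on the real line.\<close>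

lemma conv_in_distribution_vec_diagonal:
  fixes M :: "nat \<Rightarrow> 'a measure" and N :: "'b measure" and I :: "'i set"
    and Y :: "nat \<Rightarrow> 'a \<Rightarrow> 'i \<Rightarrow> real" and W :: "nat \<Rightarrow> 'a \<Rightarrow> real" and X :: "'b \<Rightarrow> real"
  assumes M: "\<And>n. prob_space (M n)" and N: "prob_space N" and I: "finite I"
    and Y: "\<And>n. Y n \<in> measurable (M n) (PiM I (\<lambda>_. borel))"
    and W: "\<And>n. W n \<in> borel_measurable (M n)" and X: "X \<in> borel_measurable N"
    and close: "\<And>\<delta>. 0 < \<delta> \<Longrightarrow>
      (\<lambda>n. measure (M n) {\<omega> \<in> space (M n). \<exists>i\<in>I. \<delta> < \<bar>Y n \<omega> i - W n \<omega>\<bar>}) \<longlonglongrightarrow> 0"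
    and cdf: "\<And>x. (\<lambda>n. measure (M n) {\<omega> \<in> space (M n). W n \<omega> \<le> x}) \<longlonglongrightarrow> measure N {\<omega> \<in> space N. X \<omega> \<le> x}"
  shows "conv_in_distribution_vec I M Y N (\<lambda>\<omega>. \<lambda>i\<in>I. X \<omega>)"
  unfolding conv_in_distribution_vec_def weak_conv_on_def
proof (intro allI impI, elim conjE)
  fix f :: "('i \<Rightarrow> real) \<Rightarrow> real"
  define P where "P = PiM I (\<lambda>_. borel :: real measure)"
  assume f: "continuous_map (product_topology (\<lambda>_. euclideanreal) I) euclideanreal f"
    and "bounded (f ` topspace (product_topology (\<lambda>_. euclideanreal) I))"
  then obtain B where B: "\<And>v. v \<in> extensional I \<Longrightarrow> \<bar>f v\<bar> \<le> B"
    by (auto simp: bounded_iff PiE_def)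
  have B0: "0 \<le> B"
    using order_trans[OF abs_ge_zero B[of "\<lambda>i\<in>I. 0"]] by simp
  have Z: "(\<lambda>\<omega>. \<lambda>i\<in>I. X \<omega>) \<in> measurable N P"
    unfolding P_def using X by (intro measurable_restrict)
  show "(\<lambda>n. \<integral>v. f v \<partial>distr (M n) (PiM I (\<lambda>_. borel)) (Y n))
      \<longlonglongrightarrow> (\<integral>v. f v \<partial>distr N (PiM I (\<lambda>_. borel)) (\<lambda>\<omega>. \<lambda>i\<in>I. X \<omega>))"
  proof (cases "f \<in> borel_measurable P")
    case False
    then show ?thesis
      by (simp add: integral_distr_not_measurable P_def)
  next
    case True
    note [measurable] = True
    define g where "g = (\<lambda>w. f (\<lambda>i\<in>I. w))"
    have "continuous_map euclideanreal (product_topology (\<lambda>_. euclideanreal) I) (\<lambda>w. \<lambda>i\<in>I. w)"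
      by (auto simp: continuous_map_componentwise)
    from continuous_map_compose[OF this f] have g: "continuous_on UNIV g"
      by (simp add: g_def o_def)
    have gB: "\<bar>g w\<bar> \<le> B" for w
      by (simp add: g_def B)
    have [measurable]: "g \<in> borel_measurable borel"
      by (rule borel_measurable_continuous_onI[OF g])
    have gW: "(\<lambda>n. \<integral>\<omega>. g (W n \<omega>) \<partial>M n) \<longlonglongrightarrow> (\<integral>\<omega>. g (X \<omega>) \<partial>N)"
      by (rule integral_tendsto_of_cdf[OF M N W X cdf g gB])
    have diff: "(\<lambda>n. (\<integral>\<omega>. f (Y n \<omega>) \<partial>M n) - (\<integral>\<omega>. g (W n \<omega>) \<partial>M n)) \<longlonglongrightarrow> 0"
    proof (rule LIMSEQ_I)
      fix a :: real assume a: "0 < a"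
      define tail where "tail = (\<lambda>K. 2 * B * (measure N {\<omega> \<in> space N. X \<omega> \<le> - K} +
        (1 - measure N {\<omega> \<in> space N. X \<omega> \<le> K})))"
\<comment> \<open>\<open>K\<close> bounds the error from large values of \<open>W n\<close>; only then can \<open>\<delta>\<close> be chosen, since it depends on \<open>K\<close>.\<close>
            obtain K where K: "tail K < a / 2"
      proof -
        interpret X: real_distribution "distr N borel X"
          by (rule prob_space.real_distribution_distr[OF N X])
        have "(\<lambda>j. tail (real j)) \<longlonglongrightarrow> 2 * B * (0 + (1 - 1))"
          unfolding tail_def cdf_distr[OF X, symmetric]
          by (intro tendsto_intros X.cdf_lim_infty_prob X.cdf_lim_neg_infty)
        then have "\<forall>\<^sub>F j in sequentially. tail (real j) < a / 2"
          by (rule order_tendstoD(2)) (use a in simp)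
        then show ?thesis
          using that by (auto simp: eventually_sequentially)
      qed
      obtain \<delta> where \<delta>: "0 < \<delta>"
        and near: "\<And>v w. v \<in> extensional I \<Longrightarrow> \<bar>w\<bar> \<le> K \<Longrightarrow> (\<And>i. i \<in> I \<Longrightarrow> \<bar>v i - w\<bar> \<le> \<delta>) \<Longrightarrow>
          \<bar>f v - f (\<lambda>i\<in>I. w)\<bar> < a / 2"
        by (rule continuous_map_uniform_near_diagonal[OF f, of "a / 2" K]) (use a in auto)
      define apart where "apart = (\<lambda>n. {\<omega> \<in> space (M n). \<exists>i\<in>I. \<delta> < \<bar>Y n \<omega> i - W n \<omega>\<bar>})"
      define low where "low = (\<lambda>n. {\<omega> \<in> space (M n). W n \<omega> \<le> - K})"
      define high where "high = (\<lambda>n. {\<omega> \<in> space (M n). \<not> W n \<omega> \<le> K})"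
      define bound where "bound = (\<lambda>n. 2 * B * (measure (M n) (apart n) + (measure (M n) (low n) +
        (1 - measure (M n) {\<omega> \<in> space (M n). W n \<omega> \<le> K}))))"
      have "bound \<longlonglongrightarrow> 2 * B * (0 + (measure N {\<omega> \<in> space N. X \<omega> \<le> - K} +
        (1 - measure N {\<omega> \<in> space N. X \<omega> \<le> K})))"
        unfolding bound_def apart_def low_def by (intro tendsto_intros close cdf \<delta>)
      then have ev: "\<forall>\<^sub>F n in sequentially. bound n < a / 2"
        by (rule order_tendstoD(2)) (use K in \<open>simp add: tail_def\<close>)
      have le: "\<bar>(\<integral>\<omega>. f (Y n \<omega>) \<partial>M n) - (\<integral>\<omega>. g (W n \<omega>) \<partial>M n)\<bar> \<le> a / 2 + bound n" for n
      proof -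
        interpret prob_space "M n" by (rule M)
        note [measurable] = W[of n] Y[of n, folded P_def]
        have Y_ext: "Y n \<omega> \<in> extensional I" if "\<omega> \<in> space (M n)" for \<omega>
          using measurable_space[OF Y that] by (auto simp: space_PiM PiE_def)
        have [measurable]: "(\<lambda>\<omega>. Y n \<omega> i) \<in> borel_measurable (M n)" if "i \<in> I" for i
          by (rule measurable_compose[OF Y measurable_component_singleton[OF that]])
        have sets: "apart n \<in> events" "low n \<in> events" "high n \<in> events"
          unfolding apart_def low_def high_def using I by measurable
        define bad where "bad = apart n \<union> low n \<union> high n"
        have bad [measurable]: "bad \<in> events" using sets by (simp add: bad_def)
        have intf: "integrable (M n) (\<lambda>\<omega>. f (Y n \<omega>))"
          by (rule integrable_const_bound[where B = B]) (use B Y_ext in \<open>auto simp: P_def\<close>)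
        have intg: "integrable (M n) (\<lambda>\<omega>. g (W n \<omega>))"
          by (rule integrable_const_bound[where B = B]) (use gB in auto)
        have intb: "integrable (M n) (\<lambda>\<omega>. a / 2 + 2 * B * indicator bad \<omega>)"
          using bad by (intro Bochner_Integration.integrable_add integrable_mult_right integrable_real_indicator)
            (auto simp: emeasure_eq_measure)
        have "\<bar>(\<integral>\<omega>. f (Y n \<omega>) \<partial>M n) - (\<integral>\<omega>. g (W n \<omega>) \<partial>M n)\<bar> =
            \<bar>\<integral>\<omega>. f (Y n \<omega>) - g (W n \<omega>) \<partial>M n\<bar>"
          using intf intg by simp
        also have "\<dots> \<le> (\<integral>\<omega>. \<bar>f (Y n \<omega>) - g (W n \<omega>)\<bar> \<partial>M n)"
          by (rule integral_abs_bound)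
        also have "\<dots> \<le> (\<integral>\<omega>. a / 2 + 2 * B * indicator bad \<omega> \<partial>M n)"
        proof (rule integral_mono)
          show "integrable (M n) (\<lambda>\<omega>. \<bar>f (Y n \<omega>) - g (W n \<omega>)\<bar>)"
            using intf intg by simp
          fix \<omega> assume \<omega>: "\<omega> \<in> space (M n)"
          show "\<bar>f (Y n \<omega>) - g (W n \<omega>)\<bar> \<le> a / 2 + 2 * B * indicator bad \<omega>"
          proof (cases "\<omega> \<in> bad")
            case True
            have "\<bar>f (Y n \<omega>)\<bar> \<le> B" "\<bar>g (W n \<omega>)\<bar> \<le> B"
              using B[OF Y_ext[OF \<omega>]] gB by auto
            then show ?thesis using True a by simp
          next
            case False
            then have "\<bar>f (Y n \<omega>) - f (\<lambda>i\<in>I. W n \<omega>)\<bar> < a / 2"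
              using \<omega> by (intro near Y_ext) (force simp: bad_def apart_def low_def high_def)+
            then show ?thesis using False by (simp add: g_def)
          qed
        qed (rule intb)
        also have "\<dots> = a / 2 + 2 * B * prob bad"
          using bad by (simp add: prob_space emeasure_eq_measure)
        also have "prob bad \<le> prob (apart n) + (prob (low n) + prob (high n))"
          unfolding bad_def Un_assoc
          using sets measure_Un_le[of "low n" "M n" "high n"] measure_Un_le[of "apart n" "M n" "low n \<union> high n"]
          by auto
        also have "prob (high n) = 1 - prob {\<omega> \<in> space (M n). W n \<omega> \<le> K}"
          unfolding high_def by (rule prob_neg) measurable
        finally show ?thesis
          using B0 by (simp add: bound_def mult_left_mono)
      qed
      from ev have "\<forall>\<^sub>F n in sequentially.
          \<bar>(\<integral>\<omega>. f (Y n \<omega>) \<partial>M n) - (\<integral>\<omega>. g (W n \<omega>) \<partial>M n)\<bar> < a"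
      proof eventually_elim
        case (elim n)
        then show ?case using le[of n] by linarith
      qed
      then show "\<exists>no. \<forall>n\<ge>no. norm ((\<integral>\<omega>. f (Y n \<omega>) \<partial>M n) - (\<integral>\<omega>. g (W n \<omega>) \<partial>M n) - 0) < a"
        by (simp add: eventually_sequentially)
    qed
    have "(\<lambda>n. \<integral>\<omega>. f (Y n \<omega>) \<partial>M n) \<longlonglongrightarrow> (\<integral>\<omega>. g (X \<omega>) \<partial>N)"
      using tendsto_add[OF diff gW] by simp
    then show ?thesis
      using True Y Z unfolding P_def by (simp add: integral_distr g_def)
  qed
qed

text \<open>There is no collection process with zero types; this discards the index zero.\<close>

lemma weak_conv_on_Suc:
  assumes "weak_conv_on T (\<lambda>n. \<mu> (Suc n)) \<nu>"
  shows "weak_conv_on T \<mu> \<nu>"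
  unfolding weak_conv_on_def
proof (intro allI impI)
  fix f :: "'a \<Rightarrow> real"
  assume "continuous_map T euclideanreal f \<and> bounded (f ` topspace T)"
  then have "(\<lambda>n. \<integral>x. f x \<partial>\<mu> (Suc n)) \<longlonglongrightarrow> (\<integral>x. f x \<partial>\<nu>)"
    by (rule assms[unfolded weak_conv_on_def, rule_format])
  then show "(\<lambda>n. \<integral>x. f x \<partial>\<mu> n) \<longlonglongrightarrow> (\<integral>x. f x \<partial>\<nu>)"
    by (rule LIMSEQ_imp_Suc)
qed

section \<open>The limit theorem\<close>

theorem corollary1p2:
  fixes k m :: nat
    and M :: "nat \<Rightarrow> 'a measure" and C :: "nat \<Rightarrow> nat \<Rightarrow> 'a \<Rightarrow> nat"
    and N :: "'b measure" and X :: "'b \<Rightarrow> real"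
  assumes "1 \<le> m" and "m \<le> k"
    and "\<And>n. 1 \<le> n \<Longrightarrow> coupon_collection (M n) n (C n)"
    and "prob_space N"
    and "distributed N lborel X (exponential_density (1 / fact (m - 1)))"
  shows "conv_in_distribution_vec {m..k}
    M (\<lambda>n \<omega>. \<lambda>i\<in>{m..k}.
         fact i * real (num_tons n m i (\<lambda>t. C n t \<omega>)) / ln (real n) ^ (i - m + 1))
    N (\<lambda>\<omega>. \<lambda>i\<in>{m..k}. X \<omega>)"
proof -
  interpret coupon_collections M C m
    by (rule coupon_collections.intro[OF assms(3,1)])
  interpret N: prob_space N by fact
  define rate :: real where "rate = 1 / fact (m - 1)"
  have rate: "0 < rate" by (simp add: rate_def)
  have dist: "distributed N lborel X (exponential_density rate)"
    using assms(5) by (simp add: rate_def)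
  have X: "X \<in> borel_measurable N"
    using distributed_measurable[OF dist] by simp
  define Y where "Y = (\<lambda>n \<omega>. \<lambda>i\<in>{m..k}. scaled_tons n i (\<lambda>t. C n t \<omega>))"
  define W where "W = (\<lambda>n \<omega>. deficit m n (collection_time n m (\<lambda>t. C n t \<omega>)))"
  have "conv_in_distribution_vec {m..k} (\<lambda>n. M (Suc n)) (\<lambda>n. Y (Suc n)) N (\<lambda>\<omega>. \<lambda>i\<in>{m..k}. X \<omega>)"
  proof (rule conv_in_distribution_vec_diagonal)
    show "prob_space (M (Suc n))" for n
    proof -
      interpret coupon_collection "M (Suc n)" "Suc n" "C (Suc n)"
        by (rule collection) simp
      show ?thesis by (rule prob_space_axioms)
    qed
    show "prob_space N" by fact
    show "finite {m..k}" by simp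
    show "Y (Suc n) \<in> measurable (M (Suc n)) (PiM {m..k} (\<lambda>_. borel))" for n
      unfolding Y_def
      by (intro measurable_restrict borel_measurable_divide borel_measurable_times
            measurable_compose[OF measurable_num_tons]) simp_all
    show "W (Suc n) \<in> borel_measurable (M (Suc n))" for n
      unfolding W_def by (intro measurable_compose[OF measurable_collection_time]) simp_all
    show "X \<in> borel_measurable N" by (rule X)
    show "(\<lambda>n. measure (M (Suc n)) {\<omega> \<in> space (M (Suc n)).
        \<exists>i\<in>{m..k}. \<delta> < \<bar>Y (Suc n) \<omega> i - W (Suc n) \<omega>\<bar>}) \<longlonglongrightarrow> 0" if \<delta>: "0 < \<delta>" for \<delta>
    proof -
      have "(\<lambda>n. measure (M n) {\<omega> \<in> space (M n). \<exists>i\<in>{m..k}. \<delta> < \<bar>Y n \<omega> i - W n \<omega>\<bar>}) \<longlonglongrightarrow> 0"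
        using scaled_tons_close_in_probability[OF \<delta>] by (simp add: Y_def W_def)
      then show ?thesis by (rule LIMSEQ_Suc)
    qed
    show "(\<lambda>n. measure (M (Suc n)) {\<omega> \<in> space (M (Suc n)). W (Suc n) \<omega> \<le> x})
        \<longlonglongrightarrow> measure N {\<omega> \<in> space N. X \<omega> \<le> x}" for x
    proof -
      have "(\<lambda>n. measure (M n) {\<omega> \<in> space (M n). W n \<omega> \<le> x}) \<longlonglongrightarrow> measure N {\<omega> \<in> space N. X \<omega> \<le> x}"
\<comment> \<open>For \<open>x \<le> 0\<close> both distribution functions vanish, eventually in \<open>n\<close>, as the deficit is positive.\<close>
            proof (cases "0 < x")
        case True
        have "measure N {\<omega> \<in> space N. X \<omega> \<le> x} = 1 - exp (- (x / fact (m - 1)))"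
          using N.exponential_distributedD_le[OF dist _ rate, of x] True by (simp add: rate_def)
        then show ?thesis
          using deficit_at_collection_time_cdf[OF True] by (simp add: W_def)
      next
        case False
        have "measure N {\<omega> \<in> space N. X \<omega> \<le> x} \<le> measure N {\<omega> \<in> space N. X \<omega> \<le> 0}"
          using X False by (intro N.finite_measure_mono) auto
        also have "\<dots> = 0"
          using N.exponential_distributedD_le[OF dist _ rate, of 0] by simp
        finally have "measure N {\<omega> \<in> space N. X \<omega> \<le> x} = 0"
          by (simp add: measure_le_0_iff)
        moreover have "\<forall>\<^sub>F n in sequentially. measure (M n) {\<omega> \<in> space (M n). W n \<omega> \<le> x} = 0"
          using eventually_ge_at_top[of 3]
        proof eventually_elim
          case (elim n)
          have "x < W n \<omega>" for \<omega>
            using deficit_pos[OF elim, of m "collection_time n m (\<lambda>t. C n t \<omega>)"] False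
            unfolding W_def by linarith
          then have "{\<omega> \<in> space (M n). W n \<omega> \<le> x} = {}"
            by (auto simp: not_le)
          then show ?case by (simp only: measure_empty)
        qed
        ultimately show ?thesis
          by (simp add: tendsto_eventually)
      qed
      then show ?thesis by (rule LIMSEQ_Suc)
    qed
  qed
  then have "conv_in_distribution_vec {m..k} M Y N (\<lambda>\<omega>. \<lambda>i\<in>{m..k}. X \<omega>)"
    unfolding conv_in_distribution_vec_def by (rule weak_conv_on_Suc)
  then show ?thesis by (simp only: Y_def)
qed

end
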